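(* Let $\tfrac12\le\gamma<1$ and let $m(q,\omega)$ be a smooth function on $\mathbb{R}\times\mathbb{S}^2$ satisfying $|(\langle q\rangle\partial_q)^k\partial_\omega^\alpha m(q,\omega)|\lesssim\langle q\rangle^{-1-2\gamma}$ for all $k,\alpha$. Set $$M(\omega)=\int_{-\infty}^\infty m(q,\omega)\,dq,\qquad \overline{M}=\frac1{4\pi}\int_{\mathbb{S}^2}M(\sigma)\,dS(\sigma),$$ and let $Q$ be a solution on $\mathbb{S}^2$ of $\Delta_\omega Q(\omega)=-M(\omega)+\overline{M}$. Let $\widetilde{\mathcal{G}_0}(q,\omega)$ be a smooth function with $|(\langle q\rangle\partial_q)^k\partial_\omega^\alpha\widetilde{\mathcal{G}_0}|\lesssim\langle q\rangle^{-2}$ for all $k,\alpha$, satisfying $$\int_{-\infty}^\infty\widetilde{\mathcal{G}_0}(q,\omega)\,dq=Q(\omega)\quad\text{for all }\omega\in\mathbb{S}^2.$$ Then there exists a smooth solution $\phi$ of $$\Box\phi+\frac{m(r-t,\omega)}{r^3}\,\chi\Big(\frac{\langle t-r\rangle}{r}\Big)=0$$ with the wave zone asymptotics $\phi\sim\mathcal{G}_0(r-t,\omega)/r$ as $r\to\infty$ with $r\sim t$, where $$\mathcal{G}_0(q,\omega)=\overline{M}\langle q\rangle^{-1}\chi_{q<0}(q)+\widetilde{\mathcal{G}_0}(q,\omega).$$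
   Context: Coordinates on $\mathbb{R}^{1+3}$ are $(t,x)$ with $x=r\omega$, $r=|x|$, $\omega\in\mathbb{S}^2$; $\Box=-\partial_t^2+\Delta_x$, $\Delta_\omega$ is the Laplacian on the unit sphere, and $\langle q\rangle=(1+q^2)^{1/2}$. $\chi$ is a smooth cutoff with $\chi(s)=1$ for $s<1/4$ and $\chi(s)=0$ for $s>1/2$. $\chi_{q<0}$ is a smooth cutoff with $\chi_{q<0}(s)=1$ for $s<-1$ and $\chi_{q<0}(s)=0$ for $s>0$. "Wave zone asymptotics $\phi\sim A$" means $A$ gives the leading term of $\phi$ as $r\to\infty$ with $r-t$ and $\omega$ fixed. *)

theory Defs
  imports "HOL-Analysis.Analysis"
begin

definition jb :: "real \<Rightarrow> real" where
  "jb q = sqrt (1 + q^2)"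

definition dd :: "'a::euclidean_space \<Rightarrow> ('a \<Rightarrow> real) \<Rightarrow> 'a \<Rightarrow> real" where
  "dd v f x = vector_derivative (\<lambda>s. f (x + s *\<^sub>R v)) (at 0)"

fun iter_dd :: "'a::euclidean_space list \<Rightarrow> ('a \<Rightarrow> real) \<Rightarrow> 'a \<Rightarrow> real" where
  "iter_dd [] f = f"
| "iter_dd (v # vs) f = dd v (iter_dd vs f)"

definition C_inf_on :: "'a::euclidean_space set \<Rightarrow> ('a \<Rightarrow> real) \<Rightarrow> bool" where
  "C_inf_on U f \<longleftrightarrow> (\<forall>vs \<in> lists Basis. \<forall>x\<in>U. iter_dd vs f differentiable (at x))"

definition ext0 :: "(real \<Rightarrow> real^3 \<Rightarrow> real) \<Rightarrow> real \<times> (real^3) \<Rightarrow> real" where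
  "ext0 f p = f (fst p) (snd p /\<^sub>R norm (snd p))"

definition smooth_RS2 :: "(real \<Rightarrow> real^3 \<Rightarrow> real) \<Rightarrow> bool" where
  "smooth_RS2 f \<longleftrightarrow> C_inf_on (UNIV \<times> (UNIV - {0})) (ext0 f)"

definition smooth_S2 :: "(real^3 \<Rightarrow> real) \<Rightarrow> bool" where
  "smooth_S2 g \<longleftrightarrow> C_inf_on (UNIV - {0}) (\<lambda>x. g (x /\<^sub>R norm x))"

definition wq :: "(real \<times> (real^3) \<Rightarrow> real) \<Rightarrow> real \<times> (real^3) \<Rightarrow> real" where
  "wq F p = jb (fst p) * dd (1, 0) F p"

text \<open>Angular derivative directions (derivatives of the homogeneous extension in x).\<close>
definition ang_dirs :: "(real \<times> (real^3)) set" where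
  "ang_dirs = {(0, e) | e. e \<in> (Basis :: (real^3) set)}"

definition symbol_bound :: "real \<Rightarrow> (real \<Rightarrow> real^3 \<Rightarrow> real) \<Rightarrow> bool" where
  "symbol_bound a f \<longleftrightarrow>
     (\<forall>k::nat. \<forall>vs \<in> lists ang_dirs. \<exists>C. \<forall>q. \<forall>\<omega>\<in>sphere 0 1.
        \<bar>(wq ^^ k) (iter_dd vs (ext0 f)) (q, \<omega>)\<bar> \<le> C * jb q powr (- a))"

text \<open>Laplace-Beltrami operator on S^2, via the degree-zero extension at |x| = 1.\<close>
definition lap_S2 :: "(real^3 \<Rightarrow> real) \<Rightarrow> real^3 \<Rightarrow> real" where
  "lap_S2 g \<omega> = (\<Sum>e\<in>(Basis :: (real^3) set). dd e (dd e (\<lambda>x. g (x /\<^sub>R norm x))) \<omega>)"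

definition sph :: "real \<Rightarrow> real \<Rightarrow> real^3" where
  "sph \<theta> \<phi> = vector [sin \<theta> * cos \<phi>, sin \<theta> * sin \<phi>, cos \<theta>]"

definition sphere_integral :: "(real^3 \<Rightarrow> real) \<Rightarrow> real" where
  "sphere_integral g = integral ({0..pi} \<times> {0..2*pi}) (\<lambda>(\<theta>, \<phi>). g (sph \<theta> \<phi>) * sin \<theta>)"

definition box :: "(real \<times> (real^3) \<Rightarrow> real) \<Rightarrow> real \<times> (real^3) \<Rightarrow> real" where
  "box \<phi> p = - dd (1, 0) (dd (1, 0) \<phi>) p
     + (\<Sum>e\<in>(Basis :: (real^3) set). dd (0, e) (dd (0, e) \<phi>) p)"

end

theory Submission
  imports Defs
begin

text \<open>The solution is the sum of a free wave and an advanced potential. A plane wave superposition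
  \<open>u(t, x) = \<integral> (\<partial>\<^sub>q G)(x \<bullet> \<sigma> - t, \<sigma>) dS(\<sigma>)\<close> solves the free wave equation and has radiation field
  \<open>2 \<pi> G\<close> for every profile \<open>G\<close> that decays as \<open>q \<longrightarrow> -\<infinity>\<close>, since for large \<open>r\<close> only directions \<open>\<sigma>\<close>
  near \<open>x / r\<close> contribute and, by Archimedes' theorem, \<open>x \<bullet> \<sigma>\<close> is uniformly distributed. The source
  \<open>m(r - t, \<omega>) r\<^sup>-\<^sup>3 \<chi>\<close> is removed by its advanced potential, the integral over the forward light cone,
  which converges because of the factor \<open>r\<^sup>-\<^sup>3\<close> and is smooth because, in the variable \<open>z = 1 / \<rho>\<close>, the
  integrand extends smoothly to \<open>z = 0\<close>. The potential has vanishing radiation field: the forward cone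
  from a far point of the wave zone meets the region where \<open>r - t\<close> is bounded only in directions close
  to \<open>\<omega>\<close>. Hence the sum of the two realises any prescribed decaying radiation field.\<close>

section \<open>Smooth functions\<close>

text \<open>The profile enters the plane waves only through its q-derivative, and only the
  oscillation of that derivative in the angle has to be estimated. The slowly decaying part of the
  prescribed field, a multiple of 1/<q>, does not depend on the angle and drops out; the rest is
  O(<q>^-3) by the symbol bound. The potential is advanced rather than retarded because the forward
  cone of a far point in the wave zone sees the source only at later times, where it is O(t^-3). One
  identity, the derivative of a spherical mean along the light cone
  (\<open>kirchhoff_deriv\<close>), serves twice: for plane waves the mean is constant, which gives
  Archimedes' theorem, and for the source it is integrated to the wave equation of the potential.
  Smoothness shapes the technical side: \<open>C_inf_on\<close> speaks of all iterated directional
  derivatives, so every integral is brought to a compact box with a smooth integrand before it is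
  differentiated. The normalisations 1/(2 pi) and 1/(4 pi) invert the factors that come from
  Archimedes' theorem and from the vertex of the cone.\<close>

lemma dd_eq:
  assumes "(f has_derivative f') (at x)"
  shows "dd v f x = f' v"
proof -
  have "((\<lambda>s::real. x + s *\<^sub>R v) has_derivative (\<lambda>s. s *\<^sub>R v)) (at 0)"
    by (auto intro!: derivative_eq_intros)
  from has_derivative_compose[OF this, of f f'] assms
  have "((\<lambda>s. f (x + s *\<^sub>R v)) has_derivative (\<lambda>s. f' (s *\<^sub>R v))) (at 0)" by simp
  then have "((\<lambda>s. f (x + s *\<^sub>R v)) has_vector_derivative f' v) (at 0)"
    using assms by (simp add: has_vector_derivative_def has_derivative_def linear_simps(5))
  then show ?thesis unfolding dd_def by (rule vector_derivative_at)
qed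

text \<open>A directional derivative \<open>dd\<close> can exist where the function is not
  differentiable, so differentiability is assumed; the coordinate derivatives are then the values of
  the linear map on \<open>Basis\<close>.\<close>

lemma has_derivative_dd:
  assumes "f differentiable (at x)"
  shows "(f has_derivative (\<lambda>h. \<Sum>b\<in>Basis. (h \<bullet> b) * dd b f x)) (at x)"
proof -
  obtain f' where f': "(f has_derivative f') (at x)" using assms by (auto simp: differentiable_def)
  then interpret bounded_linear f' by (rule has_derivative_bounded_linear)
  have "f' h = (\<Sum>b\<in>Basis. (h \<bullet> b) * dd b f x)" for h
  proof -
    have "f' h = f' (\<Sum>b\<in>Basis. (h \<bullet> b) *\<^sub>R b)" by (simp add: euclidean_representation)
    also have "\<dots> = (\<Sum>b\<in>Basis. (h \<bullet> b) * f' b)" by (simp add: sum scaleR)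
    finally show ?thesis by (simp add: dd_eq[OF f'])
  qed
  then have "f' = (\<lambda>h. \<Sum>b\<in>Basis. (h \<bullet> b) * dd b f x)" by auto
  with f' show ?thesis by simp
qed

text \<open>\<open>dd\<close> is local. This allows a formula valid only on an open set to be
  differentiated again and again.\<close>

lemma dd_cong_open:
  assumes "open U" "x \<in> U" "\<And>y. y \<in> U \<Longrightarrow> f y = g y"
  shows "dd v f x = dd v g x"
proof -
  have "((\<lambda>s::real. x + s *\<^sub>R v) \<longlongrightarrow> x + 0 *\<^sub>R v) (nhds 0)"
    by (intro tendsto_intros filterlim_ident)
  then have "\<forall>\<^sub>F s in nhds (0::real). x + s *\<^sub>R v \<in> U"
    using assms(1,2) by (auto dest!: topological_tendstoD[of _ _ _ U])
  then have "\<forall>\<^sub>F s in nhds (0::real). s \<in> UNIV \<longrightarrow> f (x + s *\<^sub>R v) = g (x + s *\<^sub>R v)"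
    by (rule eventually_mono) (simp add: assms(3))
  then show ?thesis unfolding dd_def by (rule vector_derivative_cong_eq) auto
qed

lemma differentiable_cong_open:
  assumes "open U" "x \<in> U" "\<And>y. y \<in> U \<Longrightarrow> f y = g y" "g differentiable (at x)"
  shows "f differentiable (at x)"
proof -
  obtain D where "(g has_derivative D) (at x)" using assms(4) by (auto simp: differentiable_def)
  then have "(f has_derivative D) (at x)"
    by (rule has_derivative_transform_within_open[OF _ assms(1,2)]) (simp add: assms(3))
  then show ?thesis by (auto simp: differentiable_def)
qed

lemma dd_const [simp]: "dd v (\<lambda>x. c) x = 0"
  by (rule dd_eq[where f' = "\<lambda>_. 0", simplified]) simp

lemma dd_add:
  assumes "f differentiable (at x)" "g differentiable (at x)"
  shows "dd v (\<lambda>x. f x + g x) x = dd v f x + dd v g x"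
proof -
  obtain f' g' where "(f has_derivative f') (at x)" "(g has_derivative g') (at x)"
    using assms by (auto simp: differentiable_def)
  then show ?thesis using dd_eq[OF has_derivative_add, of f f' x g g' v] by (simp add: dd_eq)
qed

lemma dd_mult:
  assumes "f differentiable (at x)" "g differentiable (at x)"
  shows "dd v (\<lambda>x. f x * g x) x = dd v f x * g x + f x * dd v g x"
proof -
  obtain f' g' where "(f has_derivative f') (at x)" "(g has_derivative g') (at x)"
    using assms by (auto simp: differentiable_def)
  then show ?thesis using dd_eq[OF has_derivative_mult, of f f' x g g' v] by (simp add: dd_eq)
qed

lemma dd_cmult:
  assumes "f differentiable (at x)"
  shows "dd v (\<lambda>x. c * f x) x = c * dd v f x"
  using dd_mult[of "\<lambda>_. c" x f v] assms by simp

lemma differentiable_componentwise_Basis: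
  fixes G :: "'b::euclidean_space \<Rightarrow> 'a::euclidean_space"
  assumes "\<And>b. b \<in> Basis \<Longrightarrow> (\<lambda>x. G x \<bullet> b) differentiable (at x)"
  shows "(G has_derivative (\<lambda>h. \<Sum>b\<in>Basis. (\<Sum>e\<in>Basis. (h \<bullet> e) * dd e (\<lambda>x. G x \<bullet> b) x) *\<^sub>R b)) (at x)"
  by (subst has_derivative_componentwise_within) (auto intro!: has_derivative_dd assms)

lemma dd_compose:
  fixes G :: "'b::euclidean_space \<Rightarrow> 'a::euclidean_space"
  assumes f: "f differentiable (at (G x))"
    and G: "\<And>b. b \<in> Basis \<Longrightarrow> (\<lambda>x. G x \<bullet> b) differentiable (at x)"
  shows "(\<lambda>x. f (G x)) differentiable (at x)"
    and "dd v (\<lambda>x. f (G x)) x = (\<Sum>b\<in>Basis. dd b f (G x) * dd v (\<lambda>x. G x \<bullet> b) x)"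
proof -
  note dG = differentiable_componentwise_Basis[of G, OF G]
  have d: "((\<lambda>x. f (G x)) has_derivative (\<lambda>h. \<Sum>c\<in>Basis. ((\<Sum>b\<in>Basis.
      (\<Sum>e\<in>Basis. (h \<bullet> e) * dd e (\<lambda>x. G x \<bullet> b) x) *\<^sub>R b) \<bullet> c) * dd c f (G x))) (at x)"
    by (rule has_derivative_compose[OF dG has_derivative_dd[OF f]])
  then show "(\<lambda>x. f (G x)) differentiable (at x)" by (auto simp: differentiable_def)
  have "dd v (\<lambda>x. G x \<bullet> b) x = (\<Sum>e\<in>Basis. (v \<bullet> e) * dd e (\<lambda>x. G x \<bullet> b) x)" if "b \<in> Basis" for b
    by (rule dd_eq[OF has_derivative_dd[OF G[OF that]]])
  then show "dd v (\<lambda>x. f (G x)) x = (\<Sum>b\<in>Basis. dd b f (G x) * dd v (\<lambda>x. G x \<bullet> b) x)"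
    by (subst dd_eq[OF d]) (simp add: mult.commute)
qed

text \<open>The polynomial expressions in the functions of \<open>B\<close>. A derivative of a
  generator is rarely a generator, but it is usually such a polynomial, so this set is the invariant
  for induction over iterated derivatives.\<close>

inductive_set alg :: "('a \<Rightarrow> real) set \<Rightarrow> ('a \<Rightarrow> real) set" for B where
  base: "f \<in> B \<Longrightarrow> f \<in> alg B"
| const: "(\<lambda>_. c) \<in> alg B"
| add: "f \<in> alg B \<Longrightarrow> g \<in> alg B \<Longrightarrow> (\<lambda>x. f x + g x) \<in> alg B"
| mult: "f \<in> alg B \<Longrightarrow> g \<in> alg B \<Longrightarrow> (\<lambda>x. f x * g x) \<in> alg B"

lemma alg_sum:
  assumes "\<And>i. i \<in> I \<Longrightarrow> f i \<in> alg B"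
  shows "(\<lambda>x. \<Sum>i\<in>I. f i x) \<in> alg B"
  using assms by (induction I rule: infinite_finite_induct) (auto intro: alg.intros)

text \<open>Coinduction up to the algebra operations: it is enough that the derivatives of the generators are
  polynomial expressions in the generators.\<close>

lemma C_inf_alg:
  assumes U: "open U"
    and diff: "\<And>f x. f \<in> B \<Longrightarrow> x \<in> U \<Longrightarrow> f differentiable (at x)"
    and dd: "\<And>f e. f \<in> B \<Longrightarrow> e \<in> Basis \<Longrightarrow> \<exists>g\<in>alg B. \<forall>x\<in>U. dd e f x = g x"
    and f: "f \<in> alg B"
  shows "C_inf_on U f"
proof -
  have 1: "(\<forall>x\<in>U. f differentiable (at x)) \<and> (\<forall>e\<in>Basis. \<exists>g\<in>alg B. \<forall>x\<in>U. dd e f x = g x)"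
    if "f \<in> alg B" for f using that
  proof induction
    case (base f) then show ?case using diff dd by blast
  next
    case (const c)
    show ?case by (auto intro: bexI[OF _ alg.const])
  next
    case (add f g)
    have "\<exists>h\<in>alg B. \<forall>x\<in>U. dd e (\<lambda>x. f x + g x) x = h x" if "e \<in> Basis" for e
    proof -
      obtain f' g' where "f' \<in> alg B" "\<forall>x\<in>U. dd e f x = f' x" "g' \<in> alg B" "\<forall>x\<in>U. dd e g x = g' x"
        using add.IH \<open>e \<in> Basis\<close> by blast
      then show ?thesis using add.IH
        by (intro bexI[of _ "\<lambda>x. f' x + g' x"]) (auto simp: dd_add intro: alg.intros)
    qed
    then show ?case using add.IH by auto
  next
    case (mult f g)
    have "\<exists>h\<in>alg B. \<forall>x\<in>U. dd e (\<lambda>x. f x * g x) x = h x" if "e \<in> Basis" for e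
    proof -
      obtain f' g' where "f' \<in> alg B" "\<forall>x\<in>U. dd e f x = f' x" "g' \<in> alg B" "\<forall>x\<in>U. dd e g x = g' x"
        using mult.IH \<open>e \<in> Basis\<close> by blast
      then show ?thesis using mult
        by (intro bexI[of _ "\<lambda>x. f' x * g x + f x * g' x"]) (auto simp: dd_mult intro: alg.intros)
    qed
    then show ?case using mult.IH by (auto intro: differentiable_mult)
  qed
  have 2: "\<exists>g\<in>alg B. \<forall>x\<in>U. iter_dd vs f x = g x" if "vs \<in> lists Basis" for vs
    using that
  proof (induction vs)
    case Nil then show ?case using f by auto
  next
    case (Cons v vs)
    then obtain g where g: "g \<in> alg B" "\<forall>x\<in>U. iter_dd vs f x = g x" by blast
    obtain h where h: "h \<in> alg B" "\<forall>x\<in>U. dd v g x = h x" using 1[OF g(1)] Cons.hyps by auto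
    have "dd v (iter_dd vs f) x = h x" if "x \<in> U" for x
      using dd_cong_open[OF U that, of "iter_dd vs f" g v] g h that by auto
    then show ?case using h by auto
  qed
  show ?thesis unfolding C_inf_on_def
  proof (intro ballI)
    fix vs :: "'a list" and x assume "vs \<in> lists Basis" "x \<in> U"
    then obtain g where "g \<in> alg B" "\<forall>x\<in>U. iter_dd vs f x = g x" using 2 by blast
    then show "iter_dd vs f differentiable at x"
      using 1 U \<open>x \<in> U\<close> by (metis differentiable_cong_open)
  qed
qed

lemma iter_dd_append: "iter_dd (vs @ ws) f = iter_dd vs (iter_dd ws f)"
  by (induction vs) simp_all

lemma C_inf_differentiable: "C_inf_on U f \<Longrightarrow> x \<in> U \<Longrightarrow> f differentiable (at x)"
proof -
  assume "C_inf_on U f" "x \<in> U"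
  then have "iter_dd [] f differentiable (at x)" unfolding C_inf_on_def by (meson lists.Nil)
  then show ?thesis by simp
qed

lemma C_inf_dd:
  fixes f :: "'a::euclidean_space \<Rightarrow> real"
  assumes "C_inf_on U f" "e \<in> Basis" shows "C_inf_on U (dd e f)"
  unfolding C_inf_on_def
proof (intro ballI)
  fix vs :: "'a list" and x :: 'a assume "vs \<in> lists Basis" "x \<in> U"
  \<comment> \<open>\<open>iter_dd\<close> applies the last list entry first, so the innermost
    derivative is appended at the end.\<close>
  then have "iter_dd (vs @ [e]) f differentiable (at x)" using assms unfolding C_inf_on_def by auto
  then show "iter_dd vs (dd e f) differentiable (at x)" by (simp add: iter_dd_append)
qed

lemma C_inf_I:
  fixes f :: "'a::euclidean_space \<Rightarrow> real"
  assumes "\<And>x. x \<in> U \<Longrightarrow> f differentiable (at x)" "\<And>e. e \<in> Basis \<Longrightarrow> C_inf_on U (dd e f)"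
  shows "C_inf_on U f"
  unfolding C_inf_on_def
proof (intro ballI)
  fix vs :: "'a list" and x :: 'a assume "vs \<in> lists Basis" "x \<in> U"
  then show "iter_dd vs f differentiable (at x)"
    using assms by (cases vs rule: rev_cases) (auto simp: iter_dd_append C_inf_on_def)
qed

lemma C_inf_continuous: "C_inf_on U f \<Longrightarrow> continuous_on U f"
  by (meson C_inf_differentiable continuous_at_imp_continuous_on differentiable_imp_continuous_within)

lemma C_inf_subset: "C_inf_on U f \<Longrightarrow> V \<subseteq> U \<Longrightarrow> C_inf_on V f"
  unfolding C_inf_on_def by blast

lemma C_inf_Un: "C_inf_on U f \<Longrightarrow> C_inf_on V f \<Longrightarrow> C_inf_on (U \<union> V) f"
  unfolding C_inf_on_def by blast

text \<open>The class of all functions smooth on \<open>U\<close> contains its own derivatives,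
  hence is itself an admissible set of generators; closure under sums and products follows at
  once.\<close>

lemma C_inf_closed_alg:
  assumes "open U" "\<And>f. f \<in> B \<Longrightarrow> C_inf_on U f" "f \<in> alg B"
  shows "C_inf_on U f"
proof (rule C_inf_alg[OF assms(1), where B = "Collect (C_inf_on U)"])
  show "f \<in> alg {f. C_inf_on U f}" using assms(3)
    by induction (auto intro: alg.intros assms(2))
qed (auto intro!: C_inf_differentiable bexI[OF _ alg.base] C_inf_dd)

lemma C_inf_const [simp, intro]: "C_inf_on U (\<lambda>x. c)"
proof -
  have "C_inf_on UNIV (\<lambda>x. c)" by (rule C_inf_alg[where B = "{}"]) (auto intro: alg.intros)
  then show ?thesis by (rule C_inf_subset) simp
qed

lemma C_inf_add:
  assumes "open U" "C_inf_on U f" "C_inf_on U g" shows "C_inf_on U (\<lambda>x. f x + g x)"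
  by (rule C_inf_closed_alg[where B = "{f, g}"]) (use assms in \<open>auto intro: alg.intros\<close>)

lemma C_inf_mult:
  assumes "open U" "C_inf_on U f" "C_inf_on U g" shows "C_inf_on U (\<lambda>x. f x * g x)"
  by (rule C_inf_closed_alg[where B = "{f, g}"]) (use assms in \<open>auto intro: alg.intros\<close>)

lemma C_inf_minus:
  assumes "open U" "C_inf_on U f" shows "C_inf_on U (\<lambda>x. - f x)"
  using C_inf_mult[OF assms(1) C_inf_const[of U "-1"] assms(2)] by simp

lemma C_inf_diff:
  assumes "open U" "C_inf_on U f" "C_inf_on U g" shows "C_inf_on U (\<lambda>x. f x - g x)"
  using C_inf_add[OF assms(1,2) C_inf_minus[OF assms(1,3)]] by simp

lemma C_inf_sum:
  assumes "open U" "\<And>i. i \<in> I \<Longrightarrow> C_inf_on U (f i)" shows "C_inf_on U (\<lambda>x. \<Sum>i\<in>I. f i x)"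
proof (rule C_inf_closed_alg[where B = "f ` I"])
  show "(\<lambda>x. \<Sum>i\<in>I. f i x) \<in> alg (f ` I)" by (rule alg_sum) (rule alg.base, simp)
qed (use assms in auto)

lemma C_inf_power:
  assumes "open U" "C_inf_on U f" shows "C_inf_on U (\<lambda>x. f x ^ n)"
  by (induction n) (auto intro!: C_inf_mult assms)

lemma C_inf_cong:
  assumes "open U" "\<And>x. x \<in> U \<Longrightarrow> f x = g x" "C_inf_on U g"
  shows "C_inf_on U f"
proof -
  have *: "\<forall>x\<in>U. iter_dd vs f x = iter_dd vs g x" for vs
    by (induction vs) (auto simp: assms(2) intro: dd_cong_open[OF assms(1)])
  show ?thesis unfolding C_inf_on_def
    using differentiable_cong_open[OF assms(1)] * assms(3) by (metis C_inf_on_def)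
qed

lemma C_inf_bounded_linear:
  assumes "bounded_linear f" shows "C_inf_on U f"
proof (rule C_inf_I)
  have d: "(f has_derivative f) (at x)" for x by (rule bounded_linear_imp_has_derivative[OF assms])
  then show "f differentiable (at x)" for x by (auto simp: differentiable_def)
  have "dd e f = (\<lambda>x. f e)" for e using dd_eq[OF d] by auto
  then show "C_inf_on U (dd e f)" for e by simp
qed

text \<open>By the chain rule, a derivative of \<open>k o G\<close> is a polynomial in functions
  \<open>k' o G\<close> with \<open>k'\<close> smooth on \<open>V\<close> and in derivatives of the
  components of \<open>G\<close>. These two families together are therefore closed in the sense of
  \<open>C_inf_alg\<close>, and no formula for higher derivatives is required.\<close>

lemma C_inf_compose:
  fixes G :: "'b::euclidean_space \<Rightarrow> 'a::euclidean_space"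
  assumes U: "open U" and f: "C_inf_on V f" and GV: "\<And>x. x \<in> U \<Longrightarrow> G x \<in> V"
    and G: "\<And>b. b \<in> Basis \<Longrightarrow> C_inf_on U (\<lambda>x. G x \<bullet> b)"
  shows "C_inf_on U (\<lambda>x. f (G x))"
proof (rule C_inf_alg[OF U, where B = "(\<lambda>k x. k (G x)) ` Collect (C_inf_on V) \<union> Collect (C_inf_on U)"])
  let ?B = "(\<lambda>k x. k (G x)) ` Collect (C_inf_on V) \<union> Collect (C_inf_on U)"
  show "(\<lambda>x. f (G x)) \<in> alg ?B" using f by (intro alg.base UnI1 image_eqI[of _ _ f] refl CollectI)
  note dG = C_inf_differentiable[OF G]
  show "h differentiable (at x)" if "h \<in> ?B" and x: "x \<in> U" for h x
  proof (cases "C_inf_on U h")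
    case True
    then show ?thesis using x by (rule C_inf_differentiable)
  next
    case False
    then obtain k where k: "C_inf_on V k" and h: "h = (\<lambda>x. k (G x))" using \<open>h \<in> ?B\<close> by blast
    show ?thesis unfolding h
      by (rule dd_compose(1)[of k G x, OF C_inf_differentiable[OF k GV[OF x]]]) (rule dG[OF _ x])
  qed
  show "\<exists>g\<in>alg ?B. \<forall>x\<in>U. dd e h x = g x" if "h \<in> ?B" and e: "e \<in> Basis" for h e
  proof (cases "C_inf_on U h")
    case True
    then have "dd e h \<in> alg ?B" by (intro alg.base UnI2 CollectI C_inf_dd e)
    then show ?thesis by (rule bexI[rotated]) simp
  next
    case False
    then obtain k where k: "C_inf_on V k" and h: "h = (\<lambda>x. k (G x))" using \<open>h \<in> ?B\<close> by blast
    let ?g = "\<lambda>x. \<Sum>b\<in>Basis. dd b k (G x) * dd e (\<lambda>x. G x \<bullet> b) x"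
    have "?g \<in> alg ?B"
    proof (intro alg_sum alg.mult)
      fix b :: 'a assume b: "b \<in> Basis"
      show "(\<lambda>x. dd b k (G x)) \<in> alg ?B" using C_inf_dd[OF k b] by (intro alg.base UnI1 image_eqI[of _ _ "dd b k"] refl CollectI)
      show "dd e (\<lambda>x. G x \<bullet> b) \<in> alg ?B" using C_inf_dd[OF G[OF b] e] by (intro alg.base UnI2 CollectI)
    qed
    moreover have "\<forall>x\<in>U. dd e h x = ?g x"
      unfolding h
      by (intro ballI dd_compose(2)[of k G] C_inf_differentiable[OF k] GV dG)
    ultimately show ?thesis by (intro bexI[of _ ?g])
  qed
qed

lemma C_inf_compose_real:
  fixes g :: "'b::euclidean_space \<Rightarrow> real"
  assumes "open U" "C_inf_on V f" "\<And>x. x \<in> U \<Longrightarrow> g x \<in> V" "C_inf_on U g"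
  shows "C_inf_on U (\<lambda>x. f (g x))"
  by (rule C_inf_compose[OF assms(1-3)]) (use assms(4) in auto)

lemma dd_real:
  assumes "(f has_real_derivative d) (at x)" shows "dd v f x = d * v"
  using dd_eq[OF assms[unfolded has_field_derivative_def]] by simp

lemma C_inf_inverse: "C_inf_on {x::real. x \<noteq> 0} inverse"
proof (rule C_inf_alg[where B = "{inverse}"])
  show "open {x::real. x \<noteq> 0}" by (simp add: open_Collect_neq)
  show "\<exists>g\<in>alg {inverse}. \<forall>x\<in>{x::real. x \<noteq> 0}. dd e f x = g x" if "f \<in> {inverse}" for f :: "real \<Rightarrow> real" and e
  proof (intro bexI[of _ "\<lambda>x. (- e) * (inverse x * inverse x)"] ballI)
    fix x :: real assume "x \<in> {x. x \<noteq> 0}"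
    then show "dd e f x = (- e) * (inverse x * inverse x)"
      using that dd_real[OF DERIV_inverse, of x e] by (simp add: power2_eq_square)
  qed (intro alg.intros; simp)
  show "f differentiable (at x)" if "f \<in> {inverse}" "x \<in> {x::real. x \<noteq> 0}" for f :: "real \<Rightarrow> real" and x
    using that DERIV_inverse by (auto simp: differentiable_def has_field_derivative_def)
qed (auto intro: alg.base)

lemma C_inf_divide:
  assumes "open U" "C_inf_on U f" "C_inf_on U g" "\<And>x. x \<in> U \<Longrightarrow> g x \<noteq> 0"
  shows "C_inf_on U (\<lambda>x. f x / g x)"
  unfolding divide_inverse
  by (intro C_inf_mult assms C_inf_compose_real[OF _ C_inf_inverse]) (use assms in auto)

text \<open>The derivative of \<open>sqrt\<close> is no polynomial in \<open>sqrt\<close>, but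
  adding its reciprocal as a second generator closes the system, since the derivative of the
  reciprocal is a multiple of its cube.\<close>

lemma C_inf_sqrt: "C_inf_on {x::real. 0 < x} sqrt"
proof (rule C_inf_alg[where B = "{sqrt, \<lambda>x. inverse (sqrt x)}"])
  let ?B = "{sqrt, \<lambda>x. inverse (sqrt x)}"
  have d1: "(sqrt has_real_derivative inverse (sqrt x) / 2) (at x)" if "x > 0" for x
    using DERIV_real_sqrt[OF that] by simp
  have d2: "((\<lambda>x. inverse (sqrt x)) has_real_derivative (- (inverse (sqrt x) * (inverse (sqrt x) / 2) * inverse (sqrt x)))) (at x)"
    if "x > 0" for x
    using DERIV_inverse'[OF d1[OF that]] that by simp
  show "open {x::real. 0 < x}" by (simp add: open_Collect_less)
  show "f differentiable (at x)" if "f \<in> ?B" "x \<in> {x. 0 < x}" for f x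
    using that d1[of x] d2[of x] by (auto simp: differentiable_def has_field_derivative_def)
  show "\<exists>g\<in>alg ?B. \<forall>x\<in>{x::real. 0 < x}. dd e f x = g x" if "f \<in> ?B" for f and e :: real
  proof (cases "f = sqrt")
    case True
    show ?thesis
      by (rule bexI[of _ "\<lambda>x. (e/2) * inverse (sqrt x)"])
         (use dd_real[OF d1] True in simp, intro alg.mult alg.const, auto intro: alg.base)
  next
    case False
    then have f: "f = (\<lambda>x. inverse (sqrt x))" using that by auto
    show ?thesis
      by (rule bexI[of _ "\<lambda>x. (-e/2) * (inverse (sqrt x) * (inverse (sqrt x) * inverse (sqrt x)))"])
         (use dd_real[OF d2] f in simp, intro alg.mult alg.const, auto intro: alg.base)
  qed
qed (auto intro: alg.base)

lemma C_inf_inner: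
  fixes f g :: "'b::euclidean_space \<Rightarrow> 'a::euclidean_space"
  assumes "open U" "\<And>b. b \<in> Basis \<Longrightarrow> C_inf_on U (\<lambda>x. f x \<bullet> b)" "\<And>b. b \<in> Basis \<Longrightarrow> C_inf_on U (\<lambda>x. g x \<bullet> b)"
  shows "C_inf_on U (\<lambda>x. f x \<bullet> g x)"
  by (subst euclidean_inner) (intro C_inf_sum C_inf_mult assms; assumption)

lemma C_inf_sqrt_compose:
  assumes "open U" "C_inf_on U f" "\<And>x. x \<in> U \<Longrightarrow> 0 < f x"
  shows "C_inf_on U (\<lambda>x. sqrt (f x))"
  by (rule C_inf_compose_real[OF _ C_inf_sqrt]) (use assms in auto)

lemma C_inf_norm:
  fixes f :: "'b::euclidean_space \<Rightarrow> 'a::euclidean_space"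
  assumes "open U" "\<And>b. b \<in> Basis \<Longrightarrow> C_inf_on U (\<lambda>x. f x \<bullet> b)" "\<And>x. x \<in> U \<Longrightarrow> f x \<noteq> 0"
  shows "C_inf_on U (\<lambda>x. norm (f x))"
proof -
  have "C_inf_on U (\<lambda>x. f x \<bullet> f x)" by (rule C_inf_inner) (use assms in auto)
  then have "C_inf_on U (\<lambda>x. sqrt (f x \<bullet> f x))" by (rule C_inf_sqrt_compose[OF assms(1)]) (use assms in auto)
  then show ?thesis by (simp add: norm_eq_sqrt_inner)
qed

lemma C_inf_jb:
  assumes "open U" "C_inf_on U f" shows "C_inf_on U (\<lambda>x. jb (f x))"
  unfolding jb_def
  by (intro C_inf_sqrt_compose C_inf_add C_inf_power C_inf_const assms) (simp add: add_pos_nonneg)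

lemma C_inf_compose_Pair:
  fixes h :: "'b::euclidean_space \<Rightarrow> 'c::euclidean_space"
  assumes "open U" "C_inf_on V f" "\<And>x. x \<in> U \<Longrightarrow> (g x, h x) \<in> V"
    and "C_inf_on U g" "\<And>b. b \<in> Basis \<Longrightarrow> C_inf_on U (\<lambda>x. h x \<bullet> b)"
  shows "C_inf_on U (\<lambda>x. f (g x, h x))"
  by (rule C_inf_compose[OF assms(1,2,3)]) (use assms(4,5) in \<open>auto simp: Basis_prod_def\<close>)

lemma C_inf_linear_intros:
  fixes a :: "'a::euclidean_space" and b :: "'b::euclidean_space"
  shows
  "C_inf_on U1 (\<lambda>x::real. x)"
  "C_inf_on U2 (\<lambda>p::real \<times> 'b. fst p)"
  "C_inf_on U3 (\<lambda>p::'b \<times> real. snd p)"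
  "C_inf_on U4 (\<lambda>p::'a \<times> 'b. snd p \<bullet> b)"
  "C_inf_on U5 (\<lambda>p::'a \<times> 'b. fst p \<bullet> a)"
  "C_inf_on U6 (\<lambda>p::(real \<times> 'b) \<times> 'c::euclidean_space. fst (fst p))"
  "C_inf_on U7 (\<lambda>p::('a \<times> 'b) \<times> 'c::euclidean_space. snd (fst p) \<bullet> b)"
  by (rule C_inf_bounded_linear, intro bounded_linear_intros)+

lemmas C_inf_intros = C_inf_const C_inf_linear_intros C_inf_add C_inf_diff C_inf_minus C_inf_mult C_inf_sum C_inf_power

lemma sum_inner_Basis:
  assumes "e \<in> Basis"
  shows "(\<Sum>b\<in>Basis. (e \<bullet> b) * g b) = g e"
proof -
  have "(\<Sum>b\<in>Basis. (e \<bullet> b) * g b) = (\<Sum>b\<in>Basis. if b = e then g b else 0)"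
    by (intro sum.cong) (auto simp: inner_Basis assms)
  then show ?thesis using assms by simp
qed

section \<open>Differentiation under the integral sign, and symmetry of second derivatives\<close>

lemma dd_Pair_left: "dd v (\<lambda>p. H (p, y)) p = dd (v, 0) H (p, y)"
  unfolding dd_def by simp

lemma differentiable_Pair_left:
  assumes "H differentiable (at (p, y))"
  shows "(\<lambda>p. H (p, y)) differentiable (at p)"
proof -
  have "((\<lambda>p. (p, y)) has_derivative (\<lambda>h. (h, 0))) (at p)"
    by (auto intro!: derivative_eq_intros)
  with assms show ?thesis
    by (auto simp: differentiable_def intro: has_derivative_compose)
qed

text \<open>The integrals with fixed \<open>w\<close> and \<open>c\<close> and with \<open>H\<close>
  ranging over the smooth functions form a family closed under derivatives, by the Leibniz rule, so
  \<open>C_inf_alg\<close> applies to it. Only the parameter \<open>p\<close> is differentiated: the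
  weight \<open>w\<close> (later sin \<theta> or \<rho>) and the parametrisation \<open>c\<close>
  (later the map to the sphere) need only be continuous.\<close>

lemma
  fixes H :: "'a::euclidean_space \<times> 'd::euclidean_space \<Rightarrow> real" and c :: "'y::euclidean_space \<Rightarrow> 'd"
  assumes U: "open U" and H: "C_inf_on W H"
    and W: "\<And>p y. p \<in> U \<Longrightarrow> y \<in> cbox a b \<Longrightarrow> (p, c y) \<in> W"
    and c: "continuous_on (cbox a b) c" and w: "continuous_on (cbox a b) w"
  shows C_inf_param_integral: "C_inf_on U (\<lambda>p. integral (cbox a b) (\<lambda>y. w y * H (p, c y)))"
    and dd_param_integral: "p \<in> U \<Longrightarrow> dd v (\<lambda>p. integral (cbox a b) (\<lambda>y. w y * H (p, c y))) p =
      integral (cbox a b) (\<lambda>y. w y * dd (v, 0) H (p, c y))"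
proof -
  have cont: "continuous_on (U \<times> cbox a b) (\<lambda>(p, y). w y * H (p, c y))" if "C_inf_on W H" for H
  proof -
    have "continuous_on (U \<times> cbox a b) (\<lambda>q. w (snd q) * H (fst q, c (snd q)))"
      by (intro continuous_intros continuous_on_compose2[OF C_inf_continuous[OF that]]
          continuous_on_compose2[OF c] continuous_on_compose2[OF w]) (auto intro: W)
    then show ?thesis by (simp add: case_prod_unfold)
  qed
  have int: "(\<lambda>y. w y * H (p, c y)) integrable_on cbox a b" if "p \<in> U" "C_inf_on W H" for H p
  proof -
    have "continuous_on (cbox a b) (\<lambda>y. (\<lambda>(p, y). w y * H (p, c y)) (p, y))"
      by (rule continuous_on_compose2[OF cont[OF that(2)]]) (use that(1) in \<open>auto intro!: continuous_intros\<close>)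
    then show ?thesis by (intro integrable_continuous) simp
  qed
  define I where "I = (\<lambda>H (p::'a). integral (cbox a b) (\<lambda>y. w y * H (p, c y)))"
  have deriv: "(I H has_derivative (\<lambda>h. \<Sum>e\<in>Basis. (h \<bullet> e) * I (dd (e, 0) H) p)) (at p)"
    if p: "p \<in> U" and H: "C_inf_on W H" for H p
  proof -
    obtain r where r: "r > 0" "ball p r \<subseteq> U" using U p openE by blast
    \<comment> \<open>The gradient of the integrand in \<open>p\<close>, packed as a bounded linear
      function because \<open>leibniz_rule\<close> asks for this type.\<close>
    define fx where "fx = (\<lambda>(p::'a) y. \<Sum>e\<in>Basis. (w y * dd (e, 0) H (p, c y)) *\<^sub>R blinfun_inner_left (e::'a))"
    have He: "C_inf_on W (dd (e, 0) H)" if "e \<in> Basis" for e :: 'a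
      by (rule C_inf_dd[OF H]) (use that in \<open>simp add: Basis_prod_def\<close>)
    have d: "(I H has_derivative integral (cbox a b) (fx p)) (at p within ball p r)"
      unfolding I_def
    proof (rule leibniz_rule)
      fix q y assume q: "q \<in> ball p r" and y: "y \<in> cbox a b"
      have "(\<lambda>p. H (p, c y)) differentiable (at q)"
        using q y r by (intro differentiable_Pair_left C_inf_differentiable[OF H] W) auto
      from has_derivative_mult_right[OF has_derivative_dd[OF this], of "w y"]
      have "((\<lambda>p. w y * H (p, c y)) has_derivative (\<lambda>h. w y * (\<Sum>e\<in>Basis. (h \<bullet> e) * dd (e, 0) H (q, c y)))) (at q)"
        by (simp add: dd_Pair_left)
      also have "(\<lambda>h. w y * (\<Sum>e\<in>Basis. (h \<bullet> e) * dd (e, 0) H (q, c y))) = blinfun_apply (fx q y)"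
        by (auto simp: fx_def blinfun.sum_left blinfun.scaleR_left sum_distrib_left algebra_simps)
      finally show "((\<lambda>p. w y * H (p, c y)) has_derivative blinfun_apply (fx q y)) (at q within ball p r)"
        by (rule has_derivative_at_withinI)
    next
      have "continuous_on (U \<times> cbox a b) (\<lambda>(p, y). fx p y)"
        unfolding fx_def case_prod_unfold
        using cont[OF He] unfolding case_prod_unfold by (intro continuous_on_sum continuous_on_scaleR continuous_on_const) auto
      then show "continuous_on (ball p r \<times> cbox a b) (\<lambda>(p, y). fx p y)"
        by (rule continuous_on_subset) (use r in auto)
    qed (use r int H in auto)
    have eq: "integral (cbox a b) (fx p) h = (\<Sum>e\<in>Basis. (h \<bullet> e) * I (dd (e, 0) H) p)" for h
    proof -
      have i: "fx p integrable_on cbox a b" unfolding fx_def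
        by (intro integrable_sum integrable_on_scaleR_left int p He finite_Basis)
      have "integral (cbox a b) (fx p) h = integral (cbox a b) (\<lambda>y. fx p y h)"
        using integral_linear[OF i, of "\<lambda>f. blinfun_apply f h"] by (simp add: o_def blinfun.bounded_linear_left)
      also have "\<dots> = integral (cbox a b) (\<lambda>y. \<Sum>e\<in>Basis. (h \<bullet> e) * (w y * dd (e, 0) H (p, c y)))"
        by (auto simp: fx_def blinfun.sum_left blinfun.scaleR_left algebra_simps)
      also have "\<dots> = (\<Sum>e\<in>Basis. (h \<bullet> e) * I (dd (e, 0) H) p)"
        unfolding I_def by (subst integral_sum) (auto intro!: integrable_on_mult_right int p He)
      finally show ?thesis .
    qed
    have "(I H has_derivative (\<lambda>h. \<Sum>e\<in>Basis. (h \<bullet> e) * I (dd (e, 0) H) p)) (at p within ball p r)"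
      by (rule has_derivative_eq_rhs[OF d]) (rule ext, rule eq)
    then show ?thesis using r(1) by (simp add: at_within_open[of p "ball p r"])
  qed
  have ddI: "dd e (I H) p = I (dd (e, 0) H) p" if "p \<in> U" "C_inf_on W H" "e \<in> Basis" for H p e
    by (subst dd_eq[OF deriv[OF that(1,2)]]) (rule sum_inner_Basis[OF that(3)])
  have "C_inf_on U (I H)"
  proof (rule C_inf_alg[OF U, where B = "I ` Collect (C_inf_on W)"])
    show "I H \<in> alg (I ` Collect (C_inf_on W))" using H by (auto intro: alg.base)
    show "f differentiable (at p)" if "f \<in> I ` Collect (C_inf_on W)" "p \<in> U" for f p
      using that deriv unfolding differentiable_def by blast
    show "\<exists>g\<in>alg (I ` Collect (C_inf_on W)). \<forall>p\<in>U. dd e f p = g p"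
      if f: "f \<in> I ` Collect (C_inf_on W)" and e: "e \<in> Basis" for f e
    proof -
      obtain H where H: "C_inf_on W H" "f = I H" using f by blast
      have "C_inf_on W (dd (e, 0) H)" by (rule C_inf_dd[OF H(1)]) (use e in \<open>simp add: Basis_prod_def\<close>)
      then have "I (dd (e, 0) H) \<in> alg (I ` Collect (C_inf_on W))" by (intro alg.base imageI CollectI)
      then show ?thesis using ddI[OF _ H(1) e] H(2) by blast
    qed
  qed
  then show "C_inf_on U (\<lambda>p. integral (cbox a b) (\<lambda>y. w y * H (p, c y)))" by (simp add: I_def)
  show "dd v (\<lambda>p. integral (cbox a b) (\<lambda>y. w y * H (p, c y))) p =
      integral (cbox a b) (\<lambda>y. w y * dd (v, 0) H (p, c y))" if p: "p \<in> U"
  proof (cases "cbox a b = {}")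
    case True then show ?thesis by simp
  next
    case False
    have "dd (v, 0) H (p, c y) = (\<Sum>e\<in>Basis. (v \<bullet> e) * dd (e, 0) H (p, c y))" if "y \<in> cbox a b" for y
      using dd_eq[OF has_derivative_dd[OF differentiable_Pair_left[OF C_inf_differentiable[OF H W[OF p that]]]], of v]
      by (simp add: dd_Pair_left)
    then have "integral (cbox a b) (\<lambda>y. w y * dd (v, 0) H (p, c y)) =
      integral (cbox a b) (\<lambda>y. \<Sum>e\<in>Basis. (v \<bullet> e) * (w y * dd (e, 0) H (p, c y)))"
      by (intro integral_cong) (simp add: sum_distrib_left algebra_simps)
    also have "\<dots> = (\<Sum>e\<in>Basis. (v \<bullet> e) * I (dd (e, 0) H) p)"
      unfolding I_def
      by (subst integral_sum)
        (auto intro!: integrable_on_mult_right int p C_inf_dd[OF H] simp: Basis_prod_def)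
    also have "\<dots> = dd v (I H) p" by (subst dd_eq[OF deriv[OF p H]]) simp
    finally show ?thesis by (simp add: I_def)
  qed
qed

lemma has_real_derivative_curve:
  fixes c :: "real \<Rightarrow> 'a::euclidean_space"
  assumes "f differentiable (at (c \<tau>))" "(c has_vector_derivative c') (at \<tau> within S)"
  shows "((\<lambda>\<tau>. f (c \<tau>)) has_real_derivative (\<Sum>b\<in>Basis. (c' \<bullet> b) * dd b f (c \<tau>))) (at \<tau> within S)"
proof -
  have "((\<lambda>\<tau>. f (c \<tau>)) has_derivative (\<lambda>h. \<Sum>b\<in>Basis. ((h *\<^sub>R c') \<bullet> b) * dd b f (c \<tau>))) (at \<tau> within S)"
    by (rule has_derivative_compose[OF assms(2)[unfolded has_vector_derivative_def] has_derivative_dd[OF assms(1)]])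
  then show ?thesis unfolding has_field_derivative_def
    by (rule has_derivative_eq_rhs) (auto simp: sum_distrib_left mult_ac)
qed

lemma has_real_derivative_line:
  assumes "f differentiable (at (x + s *\<^sub>R v))"
  shows "((\<lambda>s. f (x + s *\<^sub>R v)) has_real_derivative dd v f (x + s *\<^sub>R v)) (at s within S)"
proof -
  have "((\<lambda>s. x + s *\<^sub>R v) has_vector_derivative v) (at s within S)"
    by (auto intro!: derivative_eq_intros simp: has_vector_derivative_def)
  from has_real_derivative_curve[of f "\<lambda>s. x + s *\<^sub>R v" s, OF assms this] show ?thesis
    using dd_eq[OF has_derivative_dd[OF assms], of v] by simp
qed

text \<open>Schwarz's theorem: the increment of \<open>f\<close> along \<open>a\<close> is an integral of \<open>dd a f\<close>, which can be
  differentiated along \<open>b\<close> under the integral sign.\<close>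

lemma dd_commute:
  fixes f :: "'a::euclidean_space \<Rightarrow> real"
  assumes f: "C_inf_on UNIV f" and a: "a \<in> Basis" and b: "b \<in> Basis"
  shows "dd a (dd b f) x = dd b (dd a f) x"
proof -
  have df: "f differentiable (at y)" for y by (rule C_inf_differentiable[OF f UNIV_I])
  have da: "C_inf_on UNIV (dd a f)" by (rule C_inf_dd[OF f a])
  define H where "H = (\<lambda>q::real \<times> real. dd a f (x + fst q *\<^sub>R b + snd q *\<^sub>R a))"
  have H: "C_inf_on UNIV H"
    unfolding H_def
    by (rule C_inf_compose[OF open_UNIV da]) (auto simp: inner_add_left intro!: C_inf_intros)
  have dH: "dd (1, 0) H (0, \<tau>) = dd b (dd a f) (x + \<tau> *\<^sub>R a)" for \<tau>
    unfolding dd_def[of "(1, 0)"] dd_def[of b] H_def by (simp add: algebra_simps)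
  have inc: "f (x + u *\<^sub>R b + s *\<^sub>R a) = f (x + u *\<^sub>R b) + integral {0..s} (\<lambda>\<tau>. H (u, \<tau>))" if "s \<ge> 0" for u s
  proof -
    have "((\<lambda>\<tau>. H (u, \<tau>)) has_integral (f (x + u *\<^sub>R b + s *\<^sub>R a) - f (x + u *\<^sub>R b + 0 *\<^sub>R a))) {0..s}"
      unfolding H_def
      by (rule fundamental_theorem_of_calculus[OF that])
         (auto simp: has_real_derivative_iff_has_vector_derivative[symmetric] intro!: has_real_derivative_line df)
    then show ?thesis by (simp add: integral_unique)
  qed
  have db: "dd b f (x + s *\<^sub>R a) = dd b f x + integral {0..s} (\<lambda>\<tau>. dd b (dd a f) (x + \<tau> *\<^sub>R a))" if "s \<ge> 0" for s
  proof -
    have "dd b f (x + s *\<^sub>R a) = dd 1 (\<lambda>u. f (x + u *\<^sub>R b + s *\<^sub>R a)) 0"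
      unfolding dd_def by (simp add: algebra_simps)
    also have "\<dots> = dd 1 (\<lambda>u. f (x + u *\<^sub>R b) + integral (cbox 0 s) (\<lambda>\<tau>. 1 * H (u, \<tau>))) 0"
      using inc[OF that] by simp
    also have "\<dots> = dd 1 (\<lambda>u. f (x + u *\<^sub>R b)) 0 + dd 1 (\<lambda>u. integral (cbox 0 s) (\<lambda>\<tau>. 1 * H (u, \<tau>))) 0"
    proof (rule dd_add)
      show "(\<lambda>u. f (x + u *\<^sub>R b)) differentiable (at 0)"
        using has_real_derivative_line[OF df, where s = 0 and x = x and v = b and S = UNIV] by (auto simp: differentiable_def has_field_derivative_def)
      have "C_inf_on UNIV (\<lambda>u. integral (cbox 0 s) (\<lambda>\<tau>. 1 * H (u, \<tau>)))"
        by (rule C_inf_param_integral[OF open_UNIV H]) auto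
      then show "(\<lambda>u. integral (cbox 0 s) (\<lambda>\<tau>. 1 * H (u, \<tau>))) differentiable (at 0)"
        by (rule C_inf_differentiable) simp
    qed
    also have "dd 1 (\<lambda>u. f (x + u *\<^sub>R b)) 0 = dd b f x" unfolding dd_def by simp
    also have "dd 1 (\<lambda>u. integral (cbox 0 s) (\<lambda>\<tau>. 1 * H (u, \<tau>))) 0 = integral (cbox 0 s) (\<lambda>\<tau>. 1 * dd (1, 0) H (0, \<tau>))"
      by (rule dd_param_integral[OF open_UNIV H]) auto
    finally show ?thesis by (simp add: dH)
  qed
  \<comment> \<open>The integral formula holds for \<open>s >= 0\<close> only, so the two
    expressions for the derivative at 0 are compared from the right, within {0..1}, where vector
    derivatives are still unique.\<close>
  have "((\<lambda>s. integral {0..s} (\<lambda>\<tau>. dd b (dd a f) (x + \<tau> *\<^sub>R a))) has_vector_derivative dd b (dd a f) (x + 0 *\<^sub>R a)) (at 0 within {0..1})"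
    by (rule integral_has_vector_derivative)
      (auto intro!: continuous_intros continuous_on_compose2[OF C_inf_continuous[OF C_inf_dd[OF da b]]])
  then have "((\<lambda>s. dd b f x + integral {0..s} (\<lambda>\<tau>. dd b (dd a f) (x + \<tau> *\<^sub>R a))) has_vector_derivative dd b (dd a f) x) (at 0 within {0..1})"
    by (auto intro!: derivative_eq_intros)
  then have 1: "((\<lambda>s. dd b f (x + s *\<^sub>R a)) has_vector_derivative dd b (dd a f) x) (at 0 within {0..1})"
    by (rule has_vector_derivative_transform[rotated 2]) (auto simp: db)
  have 2: "((\<lambda>s. dd b f (x + s *\<^sub>R a)) has_vector_derivative dd a (dd b f) x) (at 0 within {0..1})"
    using has_real_derivative_line[where f = "dd b f" and x = x and s = 0 and v = a and S = "{0..1}",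
        OF C_inf_differentiable[OF C_inf_dd[OF f b] UNIV_I]]
    by (simp add: has_real_derivative_iff_has_vector_derivative)
  show ?thesis
    by (rule vector_derivative_unique_within_closed_interval[where a = 0 and b = 1 and x = "0::real", unfolded cbox_interval, OF _ _ 2 1]) auto
qed

section \<open>Integration over the sphere\<close>

lemma Basis_vec3: "(Basis :: (real^3) set) = {axis 1 1, axis 2 1, axis 3 1}"
  by (auto simp: Basis_vec_def UNIV_3)

lemma sum_Basis_Pair:
  "(\<Sum>b\<in>(Basis :: ('a::euclidean_space \<times> 'b::euclidean_space) set). g b) =
    (\<Sum>a\<in>Basis. g (a, 0)) + (\<Sum>b\<in>Basis. g (0, b))"
proof -
  have "(\<Sum>b\<in>(Basis :: ('a \<times> 'b) set). g b) = sum g ((\<lambda>u. (u, 0)) ` Basis) + sum g ((\<lambda>u. (0, u)) ` Basis)"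
    unfolding Basis_prod_def by (rule sum.union_disjoint) auto
  then show ?thesis by (simp add: sum.reindex inj_on_def)
qed

definition e_theta :: "real \<Rightarrow> real \<Rightarrow> real^3" where
  "e_theta \<theta> \<phi> = vector [cos \<theta> * cos \<phi>, cos \<theta> * sin \<phi>, - sin \<theta>]"

definition e_phi :: "real \<Rightarrow> real^3" where
  "e_phi \<phi> = vector [- sin \<phi>, cos \<phi>, 0]"

lemma vector3_eq: "(vector [a, b, c] :: real^3) = a *\<^sub>R axis 1 1 + (b *\<^sub>R axis 2 1 + c *\<^sub>R axis 3 1)"
  by (simp add: vec_eq_iff forall_3 axis_def)

lemmas frame_defs = sph_def e_theta_def e_phi_def vector3_eq

lemma inner_axis_axis3 [simp]:
  "(axis 1 1 :: real^3) \<bullet> axis 1 1 = 1" "(axis 2 1 :: real^3) \<bullet> axis 2 1 = 1" "(axis 3 1 :: real^3) \<bullet> axis 3 1 = 1"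
  "(axis 1 1 :: real^3) \<bullet> axis 2 1 = 0" "(axis 1 1 :: real^3) \<bullet> axis 3 1 = 0" "(axis 2 1 :: real^3) \<bullet> axis 1 1 = 0"
  "(axis 2 1 :: real^3) \<bullet> axis 3 1 = 0" "(axis 3 1 :: real^3) \<bullet> axis 1 1 = 0" "(axis 3 1 :: real^3) \<bullet> axis 2 1 = 0"
  by (simp_all add: inner_axis_axis)

lemma sin_mult_self: "sin x * sin x = 1 - cos x * cos (x::real)"
  using sin_squared_eq[of x] by (simp add: power2_eq_square)

lemma norm_sph [simp]: "norm (sph \<theta> \<phi>) = 1"
proof -
  have "sph \<theta> \<phi> \<bullet> sph \<theta> \<phi> = 1"
    unfolding frame_defs
    by (simp add: inner_add_left inner_add_right) (use sin_mult_self[of \<theta>] sin_mult_self[of \<phi>] in algebra)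
  then show ?thesis by (simp add: norm_eq_sqrt_inner)
qed

text \<open>Orthogonality of the matrix of the frame, in the form of the completeness relation (the
  projections onto the three frame vectors add up to the identity): this is what splits a trace into
  a radial and two tangential parts.\<close>

lemma frame_orthonormal:
  assumes "e \<in> Basis" "d \<in> Basis"
  shows "(sph \<theta> \<phi> \<bullet> e) * (sph \<theta> \<phi> \<bullet> d) + (e_theta \<theta> \<phi> \<bullet> e) * (e_theta \<theta> \<phi> \<bullet> d)
    + (e_phi \<phi> \<bullet> e) * (e_phi \<phi> \<bullet> d) = (if e = d then 1 else 0)"
proof -
  have "e = axis 1 1 \<or> e = axis 2 1 \<or> e = axis 3 1" "d = axis 1 1 \<or> d = axis 2 1 \<or> d = axis 3 1"
    using assms by (auto simp: Basis_vec3)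
  moreover have
    "sin \<theta> * cos \<phi> * (sin \<theta> * cos \<phi>) + cos \<theta> * cos \<phi> * (cos \<theta> * cos \<phi>) + sin \<phi> * sin \<phi> = 1"
    "sin \<theta> * cos \<phi> * (sin \<theta> * sin \<phi>) + cos \<theta> * cos \<phi> * (cos \<theta> * sin \<phi>) = sin \<phi> * cos \<phi>"
    "sin \<theta> * sin \<phi> * (sin \<theta> * cos \<phi>) + cos \<theta> * sin \<phi> * (cos \<theta> * cos \<phi>) = cos \<phi> * sin \<phi>"
    "sin \<theta> * sin \<phi> * (sin \<theta> * sin \<phi>) + cos \<theta> * sin \<phi> * (cos \<theta> * sin \<phi>) + cos \<phi> * cos \<phi> = 1"
    using sin_mult_self[of \<theta>] sin_mult_self[of \<phi>] by algebra+
  ultimately show ?thesis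
    by (elim disjE; simp add: frame_defs inner_add_left inner_diff_left axis_eq_axis)
qed

text \<open>The left side is the horizontal unit vector at longitude \<phi>, which is minus the
  derivative of \<open>e_phi\<close>. Its component along \<open>e_theta\<close> will cancel the
  term with cos \<theta> that arises when sin \<theta> is differentiated.\<close>

lemma frame_equator:
  "e_phi (\<phi> - pi / 2) = sin \<theta> *\<^sub>R sph \<theta> \<phi> + cos \<theta> *\<^sub>R e_theta \<theta> \<phi>"
  unfolding sph_def e_theta_def e_phi_def
  by (simp add: vec_eq_iff forall_3 sin_diff cos_diff) (use sin_mult_self[of \<theta>] in algebra)

lemma frame_derivs:
  "((\<lambda>\<theta>. sph \<theta> \<phi>) has_vector_derivative e_theta \<theta> \<phi>) (at \<theta> within S)"
  "((\<lambda>\<theta>. e_theta \<theta> \<phi>) has_vector_derivative - sph \<theta> \<phi>) (at \<theta> within S)"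
  "((\<lambda>\<phi>. sph \<theta> \<phi>) has_vector_derivative sin \<theta> *\<^sub>R e_phi \<phi>) (at \<phi> within T)"
  "((\<lambda>\<phi>. e_phi \<phi>) has_vector_derivative - e_phi (\<phi> - pi / 2)) (at \<phi> within T)"
  unfolding frame_defs
  by (auto intro!: derivative_eq_intros simp: sin_diff cos_diff algebra_simps)

lemma continuous_on_frame:
  "continuous_on S (\<lambda>y::real \<times> real. sph (fst y) (snd y))"
  "continuous_on S (\<lambda>y::real \<times> real. e_theta (fst y) (snd y))"
  "continuous_on S (\<lambda>y::real \<times> real. e_phi (snd y))"
  unfolding frame_defs by (intro continuous_intros)+

lemma sphere_integral_eq:
  "sphere_integral g = integral (cbox (0, 0) (pi, 2 * pi)) (\<lambda>y. sin (fst y) * g (sph (fst y) (snd y)))"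
  unfolding sphere_integral_def by (simp add: cbox_Pair_eq case_prod_unfold mult.commute)

lemma sphere_integrable:
  assumes "continuous_on (sphere 0 1) g"
  shows "(\<lambda>y. sin (fst y) * g (sph (fst y) (snd y))) integrable_on cbox (0, 0) (pi, 2 * pi)"
  by (intro integrable_continuous continuous_intros continuous_on_compose2[OF assms] continuous_on_frame) auto

lemma sphere_integral_cong:
  assumes "\<And>\<sigma>. norm \<sigma> = 1 \<Longrightarrow> f \<sigma> = g \<sigma>" shows "sphere_integral f = sphere_integral g"
  unfolding sphere_integral_eq by (simp add: assms)

lemma sphere_integral_add:
  assumes "continuous_on (sphere 0 1) f" "continuous_on (sphere 0 1) g"
  shows "sphere_integral (\<lambda>\<sigma>. f \<sigma> + g \<sigma>) = sphere_integral f + sphere_integral g"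
  unfolding sphere_integral_eq
  by (subst integral_add[symmetric]) (auto intro!: sphere_integrable assms simp: distrib_left)

lemma sphere_integral_cmult: "sphere_integral (\<lambda>\<sigma>. c * f \<sigma>) = c * sphere_integral f"
  unfolding sphere_integral_eq by (subst integral_mult_right[symmetric]) (simp add: mult.left_commute)

lemma sphere_integral_diff:
  assumes "continuous_on (sphere 0 1) f" "continuous_on (sphere 0 1) g"
  shows "sphere_integral (\<lambda>\<sigma>. f \<sigma> - g \<sigma>) = sphere_integral f - sphere_integral g"
  unfolding sphere_integral_eq
  by (subst integral_diff[symmetric]) (auto intro!: sphere_integrable assms simp: right_diff_distrib)

lemma sphere_integral_bound:
  assumes "continuous_on (sphere 0 1) f" "continuous_on (sphere 0 1) g"
    and "\<And>\<sigma>. norm \<sigma> = 1 \<Longrightarrow> \<bar>f \<sigma>\<bar> \<le> g \<sigma>"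
  shows "\<bar>sphere_integral f\<bar> \<le> sphere_integral g"
  unfolding sphere_integral_eq real_norm_def[symmetric]
proof (rule integral_norm_bound_integral)
  fix y :: "real \<times> real" assume "y \<in> cbox (0, 0) (pi, 2 * pi)"
  then have "0 \<le> sin (fst y)" by (auto simp: cbox_Pair_eq intro: sin_ge_zero)
  then show "norm (sin (fst y) * f (sph (fst y) (snd y))) \<le> sin (fst y) * g (sph (fst y) (snd y))"
    by (auto simp: abs_mult intro!: mult_left_mono assms(3))
qed (intro sphere_integrable assms)+

lemma sphere_integral_const: "sphere_integral (\<lambda>_. c) = 4 * pi * c"
proof -
  have "sphere_integral (\<lambda>_. c) = integral (cbox 0 pi) (\<lambda>\<theta>. integral (cbox 0 (2 * pi)) (\<lambda>\<phi>::real. sin \<theta> * c))"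
    unfolding sphere_integral_eq
    by (subst integral_prod_continuous) (auto intro!: continuous_intros)
  also have "\<dots> = integral {0..pi} (\<lambda>\<theta>. (2 * pi * c) * sin \<theta>)"
    by (simp add: algebra_simps)
  also have "\<dots> = 4 * pi * c" by (subst integral_mult_right) simp
  finally show ?thesis .
qed

lemma
  fixes H :: "'a::euclidean_space \<times> (real^3) \<Rightarrow> real"
  assumes U: "open U" and H: "C_inf_on W H"
    and W: "\<And>p \<sigma>. p \<in> U \<Longrightarrow> norm \<sigma> = 1 \<Longrightarrow> (p, \<sigma>) \<in> W"
  shows C_inf_sphere_integral: "C_inf_on U (\<lambda>p. sphere_integral (\<lambda>\<sigma>. H (p, \<sigma>)))"
    and dd_sphere_integral: "p \<in> U \<Longrightarrow> dd v (\<lambda>p. sphere_integral (\<lambda>\<sigma>. H (p, \<sigma>))) p =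
      sphere_integral (\<lambda>\<sigma>. dd (v, 0) H (p, \<sigma>))"
  unfolding sphere_integral_eq
  by (rule C_inf_param_integral[OF U H] dd_param_integral[OF U H], simp add: W,
      intro continuous_on_frame, intro continuous_intros, assumption?)+

text \<open>The difference of the two integrands, multiplied by \<open>sin \<theta>\<close>, is
  \<open>\<partial>\<^sub>\<theta> (sin \<theta> (e\<^sub>\<theta> \<bullet> V)) + \<partial>\<^sub>\<phi> (e\<^sub>\<phi> \<bullet> V)\<close>; in this form the poles need no special care.\<close>

lemma sphere_divergence:
  fixes V :: "real^3 \<Rightarrow> real \<times> (real^3) \<Rightarrow> real"
  assumes V: "\<And>e. e \<in> Basis \<Longrightarrow> C_inf_on UNIV (V e)"
  shows "sphere_integral (\<lambda>\<sigma>. 2 * (\<Sum>e\<in>Basis. (\<sigma> \<bullet> e) * V e (s, x + \<rho> *\<^sub>R \<sigma>))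
      + \<rho> * (\<Sum>e\<in>Basis. \<Sum>d\<in>Basis. (\<sigma> \<bullet> e) * (\<sigma> \<bullet> d) * dd (0, d) (V e) (s, x + \<rho> *\<^sub>R \<sigma>)))
    = sphere_integral (\<lambda>\<sigma>. \<rho> * (\<Sum>e\<in>Basis. dd (0, e) (V e) (s, x + \<rho> *\<^sub>R \<sigma>)))"
proof -
  define P where "P = (\<lambda>\<theta> \<phi>. (s, x + \<rho> *\<^sub>R sph \<theta> \<phi>))"
  define D where "D = (\<lambda>e d \<theta> \<phi>. dd (0, d) (V e) (P \<theta> \<phi>))"
  define A where "A = (\<lambda>\<theta> \<phi>. sin \<theta> * (\<Sum>e\<in>Basis. (e_theta \<theta> \<phi> \<bullet> e) * V e (P \<theta> \<phi>)))"
  define A' where "A' = (\<lambda>\<theta> \<phi>. cos \<theta> * (\<Sum>e\<in>Basis. (e_theta \<theta> \<phi> \<bullet> e) * V e (P \<theta> \<phi>)) +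
    sin \<theta> * (\<Sum>e\<in>Basis. (e_theta \<theta> \<phi> \<bullet> e) * (\<Sum>d\<in>Basis. \<rho> * (e_theta \<theta> \<phi> \<bullet> d) * D e d \<theta> \<phi>)
       - (sph \<theta> \<phi> \<bullet> e) * V e (P \<theta> \<phi>)))"
  define B where "B = (\<lambda>\<theta> \<phi>. \<Sum>e\<in>Basis. (e_phi \<phi> \<bullet> e) * V e (P \<theta> \<phi>))"
  define B' where "B' = (\<lambda>\<theta> \<phi>. \<Sum>e\<in>Basis. (e_phi \<phi> \<bullet> e) * (\<Sum>d\<in>Basis. \<rho> * (sin \<theta> * (e_phi \<phi> \<bullet> d)) * D e d \<theta> \<phi>)
     - (e_phi (\<phi> - pi / 2) \<bullet> e) * V e (P \<theta> \<phi>))"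
  have dV: "V e differentiable (at p)" if "e \<in> Basis" for e p
    by (rule C_inf_differentiable[OF V[OF that] UNIV_I])
  have Pt: "((\<lambda>\<theta>. P \<theta> \<phi>) has_vector_derivative (0, \<rho> *\<^sub>R e_theta \<theta> \<phi>)) (at \<theta> within S)" for \<theta> \<phi> S
    unfolding P_def by (auto intro!: derivative_eq_intros frame_derivs)
  have Pp: "((\<lambda>\<phi>. P \<theta> \<phi>) has_vector_derivative (0, \<rho> *\<^sub>R sin \<theta> *\<^sub>R e_phi \<phi>)) (at \<phi> within S)" for \<theta> \<phi> S
    unfolding P_def by (auto intro!: derivative_eq_intros frame_derivs)
  have inner_deriv: "((\<lambda>\<tau>. f \<tau> \<bullet> e) has_real_derivative f' \<bullet> e) (at \<tau> within S)"
    if "(f has_vector_derivative f') (at \<tau> within S)" for f :: "real \<Rightarrow> real^3" and f' e \<tau> S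
    using bounded_linear.has_vector_derivative[OF bounded_linear_inner_left that]
    by (simp add: has_real_derivative_iff_has_vector_derivative)
  have Vt: "((\<lambda>\<theta>. V e (P \<theta> \<phi>)) has_real_derivative (\<Sum>d\<in>Basis. \<rho> * (e_theta \<theta> \<phi> \<bullet> d) * D e d \<theta> \<phi>)) (at \<theta> within S)"
    if "e \<in> Basis" for e \<theta> \<phi> S
    using has_real_derivative_curve[OF dV[OF that] Pt] by (simp add: sum_Basis_Pair D_def)
  have Vp: "((\<lambda>\<phi>. V e (P \<theta> \<phi>)) has_real_derivative (\<Sum>d\<in>Basis. \<rho> * (sin \<theta> * (e_phi \<phi> \<bullet> d)) * D e d \<theta> \<phi>)) (at \<phi> within S)"
    if "e \<in> Basis" for e \<theta> \<phi> S
    using has_real_derivative_curve[OF dV[OF that] Pp] by (simp add: sum_Basis_Pair D_def mult.assoc)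
  have dA: "((\<lambda>\<theta>. A \<theta> \<phi>) has_real_derivative A' \<theta> \<phi>) (at \<theta> within S)" for \<theta> \<phi> S
    unfolding A_def A'_def
    by (auto intro!: derivative_eq_intros Vt inner_deriv frame_derivs simp: algebra_simps)
  have dB: "((\<lambda>\<phi>. B \<theta> \<phi>) has_real_derivative B' \<theta> \<phi>) (at \<phi> within S)" for \<theta> \<phi> S
    unfolding B_def B'_def
    by (auto intro!: derivative_eq_intros Vp inner_deriv frame_derivs simp: algebra_simps)
  have cP: "continuous_on S (\<lambda>y. P (fst y) (snd y))" for S
    unfolding P_def by (intro continuous_intros continuous_on_frame)
  have cV: "continuous_on S (\<lambda>y. V e (P (fst y) (snd y)))" if "e \<in> Basis" for e S
    by (rule continuous_on_compose2[OF C_inf_continuous[OF V[OF that]] cP]) auto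
  have cD: "continuous_on S (\<lambda>y. D e d (fst y) (snd y))" if "e \<in> Basis" "d \<in> Basis" for e d S
    unfolding D_def
    by (rule continuous_on_compose2[OF C_inf_continuous[OF C_inf_dd[OF V]] cP]) (use that in \<open>auto simp: Basis_prod_def\<close>)
  have ce: "continuous_on S (\<lambda>y::real \<times> real. e_phi (snd y - pi / 2))" for S
    unfolding frame_defs by (intro continuous_intros)
  have cA': "continuous_on S (\<lambda>y. A' (fst y) (snd y))" for S
    unfolding A'_def by (intro continuous_intros continuous_on_frame cV cD)
  have cB': "continuous_on S (\<lambda>y. B' (fst y) (snd y))" for S
    unfolding B'_def by (intro continuous_intros continuous_on_frame cV cD ce)
  have iA: "integral (cbox 0 pi) (\<lambda>\<theta>. A' \<theta> \<phi>) = A pi \<phi> - A 0 \<phi>" for \<phi>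
    by (intro integral_unique, unfold cbox_interval, intro fundamental_theorem_of_calculus)
       (use dA in \<open>auto simp: has_real_derivative_iff_has_vector_derivative\<close>)
  have iB: "integral (cbox 0 (2 * pi)) (\<lambda>\<phi>. B' \<theta> \<phi>) = B \<theta> (2 * pi) - B \<theta> 0" for \<theta>
    by (intro integral_unique, unfold cbox_interval, intro fundamental_theorem_of_calculus)
       (use dB in \<open>auto simp: has_real_derivative_iff_has_vector_derivative\<close>)
  \<comment> \<open>Both total derivatives integrate to zero: \<open>A\<close> carries the factor
    sin \<theta>, which vanishes at the poles, and \<open>B\<close> is periodic in \<phi>. For
    \<open>A'\<close> the order of integration is exchanged so that \<theta> is the inner
    variable.\<close>
  have "integral (cbox (0, 0) (pi, 2 * pi)) (\<lambda>y. A' (fst y) (snd y)) =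
    integral (cbox 0 pi) (\<lambda>\<theta>. integral (cbox 0 (2 * pi)) (\<lambda>\<phi>. A' \<theta> \<phi>))"
    by (subst integral_prod_continuous[OF cA']) simp
  also have "\<dots> = integral (cbox 0 (2 * pi)) (\<lambda>\<phi>. integral (cbox 0 pi) (\<lambda>\<theta>. A' \<theta> \<phi>))"
    by (rule integral_swap_continuous) (use cA' in \<open>simp add: case_prod_unfold\<close>)
  finally have intA: "integral (cbox (0, 0) (pi, 2 * pi)) (\<lambda>y. A' (fst y) (snd y)) = 0"
    by (simp only: iA) (simp add: A_def)
  have "integral (cbox (0, 0) (pi, 2 * pi)) (\<lambda>y. B' (fst y) (snd y)) =
    integral (cbox 0 pi) (\<lambda>\<theta>. integral (cbox 0 (2 * pi)) (\<lambda>\<phi>. B' \<theta> \<phi>))"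
    by (subst integral_prod_continuous[OF cB']) simp
  then have intB: "integral (cbox (0, 0) (pi, 2 * pi)) (\<lambda>y. B' (fst y) (snd y)) = 0"
    by (simp only: iB) (simp add: B_def P_def sph_def e_phi_def)
  \<comment> \<open>The tangential parts of the trace are the derivative terms of \<open>A'\<close>
    and \<open>B'\<close>. Differentiating \<open>e_theta\<close> and \<open>e_phi\<close>
    contributes the radial component of \<open>V\<close> once each, whence the factor 2.\<close>
  have key: "sin \<theta> * (\<rho> * (\<Sum>e\<in>Basis. D e e \<theta> \<phi>)) =
      sin \<theta> * (2 * (\<Sum>e\<in>Basis. (sph \<theta> \<phi> \<bullet> e) * V e (P \<theta> \<phi>)) +
       \<rho> * (\<Sum>e\<in>Basis. \<Sum>d\<in>Basis. (sph \<theta> \<phi> \<bullet> e) * (sph \<theta> \<phi> \<bullet> d) * D e d \<theta> \<phi>)) + A' \<theta> \<phi> + B' \<theta> \<phi>"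
    for \<theta> \<phi>
  proof -
    let ?r = "sph \<theta> \<phi>" and ?t = "e_theta \<theta> \<phi>" and ?p = "e_phi \<phi>"
    have tr: "(\<Sum>e\<in>Basis. D e e \<theta> \<phi>) = (\<Sum>e\<in>Basis. \<Sum>d\<in>Basis.
        ((?r \<bullet> e) * (?r \<bullet> d) + (?t \<bullet> e) * (?t \<bullet> d) + (?p \<bullet> e) * (?p \<bullet> d)) * D e d \<theta> \<phi>)"
      by (intro sum.cong refl) (simp add: frame_orthonormal if_distrib[where f = "\<lambda>a. a * _"] cong: if_cong)
    show ?thesis
      unfolding A'_def B'_def tr frame_equator[of \<phi> \<theta>]
      by (simp add: inner_add_left sum.distrib sum_subtractf sum_distrib_left algebra_simps)
  qed
  have "sphere_integral (\<lambda>\<sigma>. \<rho> * (\<Sum>e\<in>Basis. dd (0, e) (V e) (s, x + \<rho> *\<^sub>R \<sigma>))) =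
    integral (cbox (0, 0) (pi, 2 * pi)) (\<lambda>y. sin (fst y) * (2 * (\<Sum>e\<in>Basis. (sph (fst y) (snd y) \<bullet> e) * V e (P (fst y) (snd y))) +
       \<rho> * (\<Sum>e\<in>Basis. \<Sum>d\<in>Basis. (sph (fst y) (snd y) \<bullet> e) * (sph (fst y) (snd y) \<bullet> d) * D e d (fst y) (snd y)))
       + A' (fst y) (snd y) + B' (fst y) (snd y))"
    unfolding sphere_integral_eq key[symmetric] by (simp add: D_def P_def)
  also have "\<dots> = integral (cbox (0, 0) (pi, 2 * pi)) (\<lambda>y. sin (fst y) * (2 * (\<Sum>e\<in>Basis. (sph (fst y) (snd y) \<bullet> e) * V e (P (fst y) (snd y))) +
       \<rho> * (\<Sum>e\<in>Basis. \<Sum>d\<in>Basis. (sph (fst y) (snd y) \<bullet> e) * (sph (fst y) (snd y) \<bullet> d) * D e d (fst y) (snd y))))"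
    by (subst integral_add integral_add, (intro integrable_continuous continuous_intros continuous_on_frame cV cD cA' cB'; assumption)+)+
      (simp add: intA intB)
  finally show ?thesis unfolding sphere_integral_eq by (simp add: D_def P_def)
qed

section \<open>The Kirchhoff identity\<close>

lemma has_real_derivative_dd:
  fixes f :: "real \<Rightarrow> real"
  assumes "f differentiable (at x)"
  shows "(f has_real_derivative dd 1 f x) (at x within S)"
proof -
  have "(f has_derivative (\<lambda>h. h * dd 1 f x)) (at x within S)"
    using has_derivative_at_withinI[OF has_derivative_dd[OF assms]] by simp
  then show ?thesis unfolding has_field_derivative_def by (simp add: mult.commute[of _ "dd 1 f x"])
qed

lemma has_real_derivative_ray:
  fixes \<sigma> x :: "real^3"
  assumes "G differentiable (at (t + c * \<rho>, x + \<rho> *\<^sub>R \<sigma>))"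
  shows "((\<lambda>\<rho>. G (t + c * \<rho>, x + \<rho> *\<^sub>R \<sigma>)) has_real_derivative
    c * dd (1, 0) G (t + c * \<rho>, x + \<rho> *\<^sub>R \<sigma>) + (\<Sum>d\<in>Basis. (\<sigma> \<bullet> d) * dd (0, d) G (t + c * \<rho>, x + \<rho> *\<^sub>R \<sigma>))) (at \<rho> within S)"
proof -
  have "((\<lambda>\<rho>. (t + c * \<rho>, x + \<rho> *\<^sub>R \<sigma>)) has_vector_derivative (c, \<sigma>)) (at \<rho> within S)"
    by (auto intro!: derivative_eq_intros simp: has_vector_derivative_def)
  from has_real_derivative_curve[of G "\<lambda>\<rho>. (t + c * \<rho>, x + \<rho> *\<^sub>R \<sigma>)", OF assms this]
  show ?thesis by (simp add: sum_Basis_Pair)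
qed

text \<open>With \<open>w(s, \<rho>)\<close> denoting \<open>\<rho>\<close> times the integral of \<open>F(s, x + \<rho> \<sigma>)\<close> over the sphere, this is
  \<open>w\<^sub>\<rho> - w\<^sub>s\<close> at \<open>s = t + \<rho>\<close>, so that its derivative along the light cone is \<open>w\<^sub>\<rho>\<^sub>\<rho> - w\<^sub>s\<^sub>s\<close>.\<close>

definition kirchhoff :: "(real \<times> (real^3) \<Rightarrow> real) \<Rightarrow> real \<Rightarrow> real^3 \<Rightarrow> real \<Rightarrow> real" where
  "kirchhoff F t x \<rho> = sphere_integral (\<lambda>\<sigma>. F (t + \<rho>, x + \<rho> *\<^sub>R \<sigma>) +
     \<rho> * ((\<Sum>e\<in>Basis. (\<sigma> \<bullet> e) * dd (0, e) F (t + \<rho>, x + \<rho> *\<^sub>R \<sigma>)) - dd (1, 0) F (t + \<rho>, x + \<rho> *\<^sub>R \<sigma>)))"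

lemma Basis_PairI: "(1, 0) \<in> (Basis :: (real \<times> 'a::euclidean_space) set)" "e \<in> Basis \<Longrightarrow> (0, e) \<in> (Basis :: (real \<times> 'a) set)"
  "a \<in> Basis \<Longrightarrow> (a, 0) \<in> (Basis :: ('b::euclidean_space \<times> 'a) set)"
  by (auto simp: Basis_prod_def)

lemma C_inf_ray:
  assumes "C_inf_on UNIV G"
  shows "C_inf_on UNIV (\<lambda>q::real \<times> (real^3). G (t + fst q, x + fst q *\<^sub>R snd q))"
  by (rule C_inf_compose_Pair[OF open_UNIV assms]) (auto simp: inner_add_left intro!: C_inf_intros)

lemma continuous_on_sphere_ray:
  assumes "C_inf_on UNIV G"
  shows "continuous_on S (\<lambda>\<sigma>::real^3. G (t, x + r *\<^sub>R \<sigma>))"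
  by (rule continuous_on_compose2[OF C_inf_continuous[OF assms]]) (auto intro!: continuous_intros)

text \<open>Differentiating along the ray produces twice the radial derivative plus \<rho> times the
  second radial derivative; \<open>sphere_divergence\<close> for the gradient of \<open>F\<close>
  trades these for \<rho> times the Laplacian under the integral. The mixed derivatives in time and
  radius cancel by Schwarz's theorem.\<close>

lemma kirchhoff_deriv:
  assumes F: "C_inf_on UNIV F"
  shows "(kirchhoff F t x has_real_derivative
    \<rho> * sphere_integral (\<lambda>\<sigma>. box F (t + \<rho>, x + \<rho> *\<^sub>R \<sigma>))) (at \<rho>)"
proof -
  define H where "H = (\<lambda>q::real \<times> (real^3). F (t + fst q, x + fst q *\<^sub>R snd q) + fst q * ((\<Sum>e\<in>Basis. (snd q \<bullet> e) *
    dd (0, e) F (t + fst q, x + fst q *\<^sub>R snd q)) - dd (1, 0) F (t + fst q, x + fst q *\<^sub>R snd q)))"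
  have Ft: "C_inf_on UNIV (dd (1, 0) F)" by (rule C_inf_dd[OF F]) (rule Basis_PairI)
  have Fe: "C_inf_on UNIV (dd (0, e) F)" if "e \<in> Basis" for e by (rule C_inf_dd[OF F]) (rule Basis_PairI(2)[OF that])
  have H: "C_inf_on UNIV H"
    unfolding H_def by (intro C_inf_intros open_UNIV C_inf_ray F Ft Fe; assumption)
  have k: "kirchhoff F t x = (\<lambda>\<rho>. sphere_integral (\<lambda>\<sigma>. H (\<rho>, \<sigma>)))"
    by (rule ext) (simp add: kirchhoff_def H_def)
  have "C_inf_on UNIV (kirchhoff F t x)" unfolding k by (rule C_inf_sphere_integral[OF open_UNIV H]) simp
  then have "(kirchhoff F t x has_real_derivative dd 1 (kirchhoff F t x) \<rho>) (at \<rho>)"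
    by (intro has_real_derivative_dd C_inf_differentiable) auto
  also have "dd 1 (kirchhoff F t x) \<rho> = sphere_integral (\<lambda>\<sigma>. dd (1, 0) H (\<rho>, \<sigma>))"
    unfolding k by (rule dd_sphere_integral[OF open_UNIV H]) auto
  also have "\<dots> = sphere_integral (\<lambda>\<sigma>. (2 * (\<Sum>e\<in>Basis. (\<sigma> \<bullet> e) * dd (0, e) F (t + \<rho>, x + \<rho> *\<^sub>R \<sigma>))
      + \<rho> * (\<Sum>e\<in>Basis. \<Sum>d\<in>Basis. (\<sigma> \<bullet> e) * (\<sigma> \<bullet> d) * dd (0, d) (dd (0, e) F) (t + \<rho>, x + \<rho> *\<^sub>R \<sigma>)))
      - \<rho> * dd (1, 0) (dd (1, 0) F) (t + \<rho>, x + \<rho> *\<^sub>R \<sigma>))"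
  proof (rule sphere_integral_cong)
    fix \<sigma> :: "real^3"
    let ?P = "\<lambda>\<rho>. (t + \<rho>, x + \<rho> *\<^sub>R \<sigma>)"
    have ray: "((\<lambda>\<rho>. G (?P \<rho>)) has_real_derivative
        dd (1, 0) G (?P \<rho>) + (\<Sum>d\<in>Basis. (\<sigma> \<bullet> d) * dd (0, d) G (?P \<rho>))) (at \<rho>)" if "C_inf_on UNIV G" for G
      using has_real_derivative_ray[of G t 1 \<rho> x \<sigma>] C_inf_differentiable[OF that] by simp
    have comm: "dd (0, e) (dd (1, 0) F) p = dd (1, 0) (dd (0, e) F) p" if "e \<in> Basis" for e p
      by (rule dd_commute[OF F]) (auto intro: Basis_PairI that)
    have "((\<lambda>\<rho>. H (\<rho>, \<sigma>)) has_real_derivative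
       dd (1, 0) F (?P \<rho>) + (\<Sum>d\<in>Basis. (\<sigma> \<bullet> d) * dd (0, d) F (?P \<rho>)) +
       (((\<Sum>e\<in>Basis. (\<sigma> \<bullet> e) * dd (0, e) F (?P \<rho>)) - dd (1, 0) F (?P \<rho>)) + \<rho> *
       ((\<Sum>e\<in>Basis. (\<sigma> \<bullet> e) * (dd (1, 0) (dd (0, e) F) (?P \<rho>) + (\<Sum>d\<in>Basis. (\<sigma> \<bullet> d) * dd (0, d) (dd (0, e) F) (?P \<rho>))))
         - (dd (1, 0) (dd (1, 0) F) (?P \<rho>) + (\<Sum>d\<in>Basis. (\<sigma> \<bullet> d) * dd (0, d) (dd (1, 0) F) (?P \<rho>)))))) (at \<rho>)"
      unfolding H_def fst_conv snd_conv
      by (rule derivative_eq_intros ray F Ft Fe refl | assumption | simp add: mult.commute)+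
    from dd_real[OF this, of 1]
    show "dd (1, 0) H (\<rho>, \<sigma>) = 2 * (\<Sum>e\<in>Basis. (\<sigma> \<bullet> e) * dd (0, e) F (?P \<rho>))
      + \<rho> * (\<Sum>e\<in>Basis. \<Sum>d\<in>Basis. (\<sigma> \<bullet> e) * (\<sigma> \<bullet> d) * dd (0, d) (dd (0, e) F) (?P \<rho>))
      - \<rho> * dd (1, 0) (dd (1, 0) F) (?P \<rho>)"
      by (simp add: dd_Pair_left comm distrib_left sum.distrib sum_distrib_left algebra_simps)
  qed
  also have "\<dots> = sphere_integral (\<lambda>\<sigma>. 2 * (\<Sum>e\<in>Basis. (\<sigma> \<bullet> e) * dd (0, e) F (t + \<rho>, x + \<rho> *\<^sub>R \<sigma>))
      + \<rho> * (\<Sum>e\<in>Basis. \<Sum>d\<in>Basis. (\<sigma> \<bullet> e) * (\<sigma> \<bullet> d) * dd (0, d) (dd (0, e) F) (t + \<rho>, x + \<rho> *\<^sub>R \<sigma>)))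
      - sphere_integral (\<lambda>\<sigma>. \<rho> * dd (1, 0) (dd (1, 0) F) (t + \<rho>, x + \<rho> *\<^sub>R \<sigma>))"
    by (rule sphere_integral_diff)
       (intro continuous_intros continuous_on_sphere_ray Fe C_inf_dd[OF Fe] C_inf_dd[OF Ft] Basis_PairI; assumption)+
  also have "sphere_integral (\<lambda>\<sigma>. 2 * (\<Sum>e\<in>Basis. (\<sigma> \<bullet> e) * dd (0, e) F (t + \<rho>, x + \<rho> *\<^sub>R \<sigma>))
      + \<rho> * (\<Sum>e\<in>Basis. \<Sum>d\<in>Basis. (\<sigma> \<bullet> e) * (\<sigma> \<bullet> d) * dd (0, d) (dd (0, e) F) (t + \<rho>, x + \<rho> *\<^sub>R \<sigma>)))
     = sphere_integral (\<lambda>\<sigma>. \<rho> * (\<Sum>e\<in>Basis. dd (0, e) (dd (0, e) F) (t + \<rho>, x + \<rho> *\<^sub>R \<sigma>)))"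
    by (rule sphere_divergence[of "\<lambda>e. dd (0, e) F", OF Fe])
  also have "\<dots> - sphere_integral (\<lambda>\<sigma>. \<rho> * dd (1, 0) (dd (1, 0) F) (t + \<rho>, x + \<rho> *\<^sub>R \<sigma>))
     = sphere_integral (\<lambda>\<sigma>. \<rho> * (\<Sum>e\<in>Basis. dd (0, e) (dd (0, e) F) (t + \<rho>, x + \<rho> *\<^sub>R \<sigma>))
         - \<rho> * dd (1, 0) (dd (1, 0) F) (t + \<rho>, x + \<rho> *\<^sub>R \<sigma>))"
    by (rule sphere_integral_diff[symmetric])
       (intro continuous_intros continuous_on_sphere_ray C_inf_dd[OF Fe] C_inf_dd[OF Ft] Basis_PairI; assumption)+
  also have "\<dots> = \<rho> * sphere_integral (\<lambda>\<sigma>. box F (t + \<rho>, x + \<rho> *\<^sub>R \<sigma>))"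
    by (subst sphere_integral_cmult[symmetric]) (simp add: box_def algebra_simps)
  finally show ?thesis .
qed

lemma kirchhoff_0: "kirchhoff F t x 0 = 4 * pi * F (t, x)"
  by (simp add: kirchhoff_def sphere_integral_const)

section \<open>Plane waves and Archimedes' theorem\<close>

lemma dd_plane_wave:
  fixes g :: "real \<Rightarrow> real" and \<omega> :: "'a::euclidean_space"
  assumes "g differentiable (at (\<omega> \<bullet> snd p + c * fst p))"
  shows "dd v (\<lambda>p. g (\<omega> \<bullet> snd p + c * fst p)) p = (\<omega> \<bullet> snd v + c * fst v) * dd 1 g (\<omega> \<bullet> snd p + c * fst p)"
proof -
  have "((\<lambda>p. \<omega> \<bullet> snd p + c * fst p) has_derivative (\<lambda>h. \<omega> \<bullet> snd h + c * fst h)) (at p)"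
    by (auto intro!: derivative_eq_intros)
  from has_derivative_compose[OF this has_derivative_dd[OF assms]]
  show ?thesis by (subst dd_eq) (assumption, simp)
qed

lemma box_plane_wave:
  assumes g: "C_inf_on UNIV g" and \<omega>: "norm \<omega> = 1" and c: "c\<^sup>2 = 1"
  shows "box (\<lambda>p. g (\<omega> \<bullet> snd p + c * fst p)) p = 0"
proof -
  have d: "dd v (dd v (\<lambda>p. g (\<omega> \<bullet> snd p + c * fst p))) p =
      (\<omega> \<bullet> snd v + c * fst v)\<^sup>2 * dd 1 (dd 1 g) (\<omega> \<bullet> snd p + c * fst p)" for v
  proof -
    have dg: "g differentiable (at y)" "dd 1 g differentiable (at y)" for y
      using C_inf_differentiable[OF g] C_inf_differentiable[OF C_inf_dd[OF g, of 1]] by auto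
    have 1: "dd v (\<lambda>p. g (\<omega> \<bullet> snd p + c * fst p)) = (\<lambda>p. (\<omega> \<bullet> snd v + c * fst v) * dd 1 g (\<omega> \<bullet> snd p + c * fst p))"
      by (rule ext) (rule dd_plane_wave[OF dg(1)])
    have diff: "(\<lambda>p. dd 1 g (\<omega> \<bullet> snd p + c * fst p)) differentiable (at p)"
    proof -
      have "((\<lambda>p. \<omega> \<bullet> snd p + c * fst p) has_derivative (\<lambda>h. \<omega> \<bullet> snd h + c * fst h)) (at p)"
        by (auto intro!: derivative_eq_intros)
      from has_derivative_compose[OF this has_derivative_dd[OF dg(2)]]
      show ?thesis by (auto simp: differentiable_def)
    qed
    show ?thesis unfolding 1 by (simp add: dd_cmult[OF diff] dd_plane_wave[OF dg(2)] power2_eq_square)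
  qed
  have "(\<Sum>e\<in>Basis. (\<omega> \<bullet> e)\<^sup>2) = 1" using \<omega>
    by (simp add: power2_eq_square euclidean_inner[symmetric] dot_square_norm)
  then show ?thesis
    unfolding box_def d by (simp add: sum_distrib_right[symmetric] power_mult_distrib c)
qed

text \<open>Archimedes: by the Kirchhoff identity for the plane waves \<open>g (\<omega> \<bullet> x \<plusminus> t)\<close>, the derivative of
  \<open>\<rho> * sphere_integral (\<lambda>\<sigma>. g (\<rho> * (\<omega> \<bullet> \<sigma>)))\<close> is \<open>2 * pi * (g \<rho> + g (- \<rho>))\<close>.\<close>

lemma sphere_integral_zonal:
  assumes g: "C_inf_on UNIV g" and f: "\<And>s. (f has_real_derivative g s) (at s)" and \<omega>: "norm \<omega> = 1"
  shows "sphere_integral (\<lambda>\<sigma>. g (\<omega> \<bullet> \<sigma>)) = 2 * pi * (f 1 - f (- 1))"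
proof -
  have dg: "g differentiable (at y)" for y by (rule C_inf_differentiable[OF g]) simp
  have C1: "C_inf_on UNIV (dd 1 g)" by (rule C_inf_dd[OF g]) simp
  have cont: "continuous_on S (\<lambda>\<sigma>. h (r * (\<omega> \<bullet> \<sigma>)))" if "C_inf_on UNIV h" for h r S
    by (rule continuous_on_compose2[OF C_inf_continuous[OF that]]) (auto intro!: continuous_intros)
  \<comment> \<open>The cone starts at time \<open>- \<rho>\<close> at the origin, so that radius
    \<rho> is reached at time 0, where the waves for both signs of \<open>c\<close> have the
    argument \<open>\<rho> * (\<omega> \<bullet> \<sigma>)\<close>. Their Kirchhoff means do not
    depend on the radius, and radius 0 gives the right-hand side.\<close>
  have K: "sphere_integral (\<lambda>\<sigma>. g (\<rho> * (\<omega> \<bullet> \<sigma>)) + \<rho> * ((\<omega> \<bullet> \<sigma>) * dd 1 g (\<rho> * (\<omega> \<bullet> \<sigma>)) - c * dd 1 g (\<rho> * (\<omega> \<bullet> \<sigma>))))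
    = 4 * pi * g (- (c * \<rho>))" if c: "c\<^sup>2 = 1" for c \<rho>
  proof -
    let ?F = "\<lambda>p. g (\<omega> \<bullet> snd p + c * fst p)"
    have F: "C_inf_on UNIV ?F"
      by (rule C_inf_compose_real[OF open_UNIV g])
         (auto simp: inner_commute[of \<omega>] intro!: C_inf_add C_inf_mult C_inf_const C_inf_linear_intros)
    have "(kirchhoff ?F (-\<rho>) 0 has_real_derivative 0) (at s)" for s
      using kirchhoff_deriv[OF F, of "-\<rho>" 0 s]
      by (simp add: box_plane_wave[OF g \<omega> c] sphere_integral_const)
    then have "kirchhoff ?F (-\<rho>) 0 \<rho> = kirchhoff ?F (-\<rho>) 0 0"
      by (intro DERIV_isconst_all allI)
    then have "kirchhoff ?F (-\<rho>) 0 \<rho> = 4 * pi * g (- (c * \<rho>))"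
      by (simp add: kirchhoff_0)
    moreover have "(\<Sum>e\<in>Basis. (\<sigma> \<bullet> e) * ((\<omega> \<bullet> e) * a)) = (\<omega> \<bullet> \<sigma>) * a" for \<sigma> a
      unfolding euclidean_inner[of \<omega> \<sigma>] sum_distrib_right by (simp add: mult_ac)
    ultimately show ?thesis
      by (simp add: kirchhoff_def dd_plane_wave[OF dg])
  qed
  define J where "J = (\<lambda>\<rho>. sphere_integral (\<lambda>\<sigma>. \<rho> * g (\<rho> * (\<omega> \<bullet> \<sigma>))))"
  have dJ: "(J has_real_derivative 2 * pi * (g \<rho> + g (- \<rho>))) (at \<rho>)" for \<rho>
  proof -
    define H where "H = (\<lambda>q::real \<times> (real^3). fst q * g (fst q * (\<omega> \<bullet> snd q)))"
    have H: "C_inf_on UNIV H" unfolding H_def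
      by (intro C_inf_mult open_UNIV C_inf_linear_intros C_inf_compose_real[OF open_UNIV g])
         (auto simp: inner_commute[of \<omega>] intro!: C_inf_mult C_inf_linear_intros)
    have J: "J = (\<lambda>\<rho>. sphere_integral (\<lambda>\<sigma>. H (\<rho>, \<sigma>)))" by (rule ext) (simp add: J_def H_def)
    have dH: "dd (1, 0) H (\<rho>, \<sigma>) = g (\<rho> * (\<omega> \<bullet> \<sigma>)) + \<rho> * ((\<omega> \<bullet> \<sigma>) * dd 1 g (\<rho> * (\<omega> \<bullet> \<sigma>)))" for \<sigma>
    proof -
      have "((\<lambda>\<rho>. H (\<rho>, \<sigma>)) has_real_derivative (g (\<rho> * (\<omega> \<bullet> \<sigma>)) + \<rho> * ((\<omega> \<bullet> \<sigma>) * dd 1 g (\<rho> * (\<omega> \<bullet> \<sigma>))))) (at \<rho>)"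
        unfolding H_def fst_conv snd_conv
        by (auto intro!: derivative_eq_intros DERIV_chain2[OF has_real_derivative_dd[OF dg]])
      from dd_real[OF this, of 1] show ?thesis by (simp add: dd_Pair_left)
    qed
    have "C_inf_on UNIV J" unfolding J by (rule C_inf_sphere_integral[OF open_UNIV H]) simp
    then have "(J has_real_derivative dd 1 J \<rho>) (at \<rho>)"
      by (intro has_real_derivative_dd C_inf_differentiable) auto
    also have "dd 1 J \<rho> = sphere_integral (\<lambda>\<sigma>. dd (1, 0) H (\<rho>, \<sigma>))"
      unfolding J by (rule dd_sphere_integral[OF open_UNIV H]) auto
    finally have 1: "(J has_real_derivative sphere_integral (\<lambda>\<sigma>. dd (1, 0) H (\<rho>, \<sigma>))) (at \<rho>)" .
    \<comment> \<open>Adding the identities for \<open>c = 1\<close> and \<open>c = -1\<close>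
      removes the time derivative.\<close>
    have "2 * sphere_integral (\<lambda>\<sigma>. dd (1, 0) H (\<rho>, \<sigma>)) = sphere_integral (\<lambda>\<sigma>. g (\<rho> * (\<omega> \<bullet> \<sigma>)) + \<rho> * ((\<omega> \<bullet> \<sigma>) * dd 1 g (\<rho> * (\<omega> \<bullet> \<sigma>)) - 1 * dd 1 g (\<rho> * (\<omega> \<bullet> \<sigma>))))
       + sphere_integral (\<lambda>\<sigma>. g (\<rho> * (\<omega> \<bullet> \<sigma>)) + \<rho> * ((\<omega> \<bullet> \<sigma>) * dd 1 g (\<rho> * (\<omega> \<bullet> \<sigma>)) - (-1) * dd 1 g (\<rho> * (\<omega> \<bullet> \<sigma>))))"
      by (subst sphere_integral_add[symmetric])
         (auto intro!: continuous_intros cont g C1 C_inf_mult simp: dH sphere_integral_cmult[symmetric] algebra_simps)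
    also have "\<dots> = 2 * (2 * pi * (g \<rho> + g (- \<rho>)))"
      using K[of 1 \<rho>] K[of "-1" \<rho>] by (simp add: algebra_simps)
    finally show ?thesis using 1 by (simp add: mult.assoc)
  qed
  define L where "L = (\<lambda>\<rho>. 2 * pi * (f \<rho> - f (- \<rho>)))"
  have dL: "(L has_real_derivative 2 * pi * (g \<rho> + g (- \<rho>))) (at \<rho>)" for \<rho>
    unfolding L_def by (auto intro!: derivative_eq_intros f DERIV_chain2[OF f])
  have "((\<lambda>\<rho>. J \<rho> - L \<rho>) has_real_derivative 0) (at \<rho>)" for \<rho>
    using DERIV_diff[OF dJ dL] by simp
  \<comment> \<open>Both functions vanish at 0, and their values at 1 are the two sides of the
    claim.\<close>
  then have "J 1 - L 1 = J 0 - L 0"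
    using DERIV_isconst_all[of "\<lambda>\<rho>. J \<rho> - L \<rho>" 1 0] by blast
  then show ?thesis by (simp add: J_def L_def sphere_integral_const)
qed

section \<open>Free waves with prescribed radiation field\<close>

lemma box_Pair_left:
  "box (\<lambda>p. H (p, y)) p = - dd ((1, 0), 0) (dd ((1, 0), 0) H) (p, y)
     + (\<Sum>e\<in>Basis. dd ((0, e), 0) (dd ((0, e), 0) H) (p, y))"
proof -
  have "dd v (\<lambda>p. H (p, y)) = (\<lambda>p. dd (v, 0) H (p, y))" for v
    by (rule ext) (rule dd_Pair_left)
  then show ?thesis by (simp add: box_def dd_Pair_left[of _ "dd _ H"])
qed

lemma box_param_integral:
  fixes H :: "(real \<times> (real^3)) \<times> 'd::euclidean_space \<Rightarrow> real" and c :: "'y::euclidean_space \<Rightarrow> 'd"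
  assumes U: "open U" and H: "C_inf_on W H"
    and W: "\<And>p y. p \<in> U \<Longrightarrow> y \<in> cbox a b \<Longrightarrow> (p, c y) \<in> W"
    and c: "continuous_on (cbox a b) c" and w: "continuous_on (cbox a b) w" and p: "p \<in> U"
  shows "box (\<lambda>p. integral (cbox a b) (\<lambda>y. w y * H (p, c y))) p =
    integral (cbox a b) (\<lambda>y. w y * box (\<lambda>p. H (p, c y)) p)"
proof -
  let ?I = "\<lambda>H p. integral (cbox a b) (\<lambda>y. w y * H (p, c y))"
  have H1: "C_inf_on W (dd (v, 0) H)" if "v \<in> Basis" for v
    by (rule C_inf_dd[OF H Basis_PairI(3)[OF that]])
  have dd2: "dd v (dd v (?I H)) p = ?I (dd (v, 0) (dd (v, 0) H)) p" if v: "v \<in> Basis" for v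
  proof -
    have "dd v (dd v (?I H)) p = dd v (?I (dd (v, 0) H)) p"
      by (rule dd_cong_open[OF U p]) (rule dd_param_integral[OF U H W c w])
    also have "\<dots> = ?I (dd (v, 0) (dd (v, 0) H)) p"
      by (rule dd_param_integral[OF U H1[OF v] W c w p])
    finally show ?thesis .
  qed
  have int: "(\<lambda>y. w y * dd (v, 0) (dd (v, 0) H) (p, c y)) integrable_on cbox a b" if "v \<in> Basis" for v
  proof (intro integrable_continuous continuous_on_mult w)
    show "continuous_on (cbox a b) (\<lambda>y. dd (v, 0) (dd (v, 0) H) (p, c y))"
      by (rule continuous_on_compose2[OF C_inf_continuous[OF C_inf_dd[OF H1[OF that] Basis_PairI(3)[OF that]]]])
         (intro continuous_intros c, use W[OF p] in auto)
  qed
  have "integral (cbox a b) (\<lambda>y. w y * box (\<lambda>p. H (p, c y)) p) = integral (cbox a b)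
    (\<lambda>y. (\<Sum>e\<in>Basis. w y * dd ((0, e), 0) (dd ((0, e), 0) H) (p, c y)) - w y * dd ((1, 0), 0) (dd ((1, 0), 0) H) (p, c y))"
    by (simp add: box_Pair_left sum_distrib_left algebra_simps)
  also have "\<dots> = (\<Sum>e\<in>Basis. ?I (dd ((0, e), 0) (dd ((0, e), 0) H)) p) - ?I (dd ((1, 0), 0) (dd ((1, 0), 0) H)) p"
    by (subst integral_diff, intro integrable_sum int Basis_PairI finite_Basis, assumption, intro int Basis_PairI,
        subst integral_sum) (auto intro!: int Basis_PairI)
  finally show ?thesis by (simp add: box_def dd2 Basis_PairI)
qed

lemma box_sphere_integral:
  assumes U: "open U" and H: "C_inf_on W H"
    and W: "\<And>p \<sigma>. p \<in> U \<Longrightarrow> norm \<sigma> = 1 \<Longrightarrow> (p, \<sigma>) \<in> W" and p: "p \<in> U"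
  shows "box (\<lambda>p. sphere_integral (\<lambda>\<sigma>. H (p, \<sigma>))) p = sphere_integral (\<lambda>\<sigma>. box (\<lambda>p. H (p, \<sigma>)) p)"
  unfolding sphere_integral_eq
  by (rule box_param_integral[OF U H _ _ _ p]; (simp add: W)?; intro continuous_on_frame continuous_intros)

text \<open>The q-derivative is there because averaging over directions integrates once in q. The
  form \<open>(-1) * fst p\<close> makes each summand an instance of the plane waves above with
  \<open>c = -1\<close>.\<close>

definition free_wave :: "(real \<times> (real^3) \<Rightarrow> real) \<Rightarrow> real \<times> (real^3) \<Rightarrow> real" where
  "free_wave G p = sphere_integral (\<lambda>\<sigma>. dd (1, 0) G (\<sigma> \<bullet> snd p + (-1) * fst p, \<sigma>))"

lemma open_punctured: "open (UNIV \<times> (UNIV - {0 :: 'a::euclidean_space}) :: ('b::euclidean_space \<times> 'a) set)"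
  by (intro open_Times) auto

lemma C_inf_profile:
  assumes "C_inf_on (UNIV \<times> (UNIV - {0})) G"
  shows "C_inf_on (UNIV \<times> (UNIV - {0})) (\<lambda>q::(real \<times> (real^3)) \<times> (real^3). G (snd q \<bullet> snd (fst q) + (-1) * fst (fst q), snd q))"
  by (rule C_inf_compose_Pair[OF open_punctured assms])
     (auto intro!: C_inf_diff C_inf_inner C_inf_linear_intros open_punctured)

lemma C_inf_slice:
  assumes "C_inf_on (UNIV \<times> (UNIV - {0})) G" "\<omega> \<noteq> 0"
  shows "C_inf_on UNIV (\<lambda>q::real. G (q, \<omega> :: real^3))"
  by (rule C_inf_compose_Pair[OF open_UNIV assms(1)]) (use assms(2) in \<open>auto intro!: C_inf_intros\<close>)

lemma
  assumes G: "C_inf_on (UNIV \<times> (UNIV - {0})) G"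
  shows C_inf_free_wave: "C_inf_on UNIV (free_wave G)"
    and box_free_wave: "box (free_wave G) p = 0"
proof -
  have h: "C_inf_on (UNIV \<times> (UNIV - {0})) (dd (1, 0) G)" by (rule C_inf_dd[OF G]) (rule Basis_PairI)
  define H where "H = (\<lambda>q. dd (1, 0) G (snd q \<bullet> snd (fst q) + (-1) * fst (fst q), snd q))"
  have H: "C_inf_on (UNIV \<times> (UNIV - {0})) H" unfolding H_def by (rule C_inf_profile[OF h])
  have u: "free_wave G = (\<lambda>p. sphere_integral (\<lambda>\<sigma>. H (p, \<sigma>)))"
    by (rule ext) (simp add: free_wave_def H_def)
  show "C_inf_on UNIV (free_wave G)"
    unfolding u by (rule C_inf_sphere_integral[OF open_UNIV H]) auto
  have "box (free_wave G) p = sphere_integral (\<lambda>\<sigma>. box (\<lambda>p. H (p, \<sigma>)) p)"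
    unfolding u by (rule box_sphere_integral[OF open_UNIV H]) auto
  also have "\<dots> = sphere_integral (\<lambda>\<sigma>. 0)"
  proof (rule sphere_integral_cong)
    fix \<sigma> :: "real^3" assume \<sigma>: "norm \<sigma> = 1"
    then have "\<sigma> \<noteq> 0" by auto
    with \<sigma> show "box (\<lambda>p. H (p, \<sigma>)) p = 0"
      using box_plane_wave[OF C_inf_slice[OF h, of \<sigma>], of \<sigma> "-1" p] by (auto simp: H_def)
  qed
  finally show "box (free_wave G) p = 0" by (simp add: sphere_integral_const)
qed

lemma jb_pos [simp]: "0 < jb q" "0 \<le> jb q" and jb_ge_1: "1 \<le> jb q" and jb_ge_abs: "\<bar>q\<bar> \<le> jb q"
  and jb_sq: "(jb q)\<^sup>2 = 1 + q\<^sup>2"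
  unfolding jb_def by (auto simp: add_pos_nonneg real_le_rsqrt)

text \<open>With the second argument of the profile frozen at \<omega>, Archimedes' theorem
  evaluates the integral exactly, as a difference of \<open>G\<close> at q and at q - 2 r; the
  second value dies by \<open>lim\<close>. The error \<open>b\<close> of freezing is dominated by
  \<epsilon> / (1 + q'^2) at retarded argument q': by uniform continuity for bounded q', by
  \<open>osc\<close> for large q'. The sphere integral of r / (1 + q'^2) stays bounded, again by
  Archimedes, with arctan as primitive.\<close>

lemma free_wave_radiation:
  assumes G: "C_inf_on (UNIV \<times> (UNIV - {0})) G" and \<omega>: "norm \<omega> = 1"
    and lim: "((\<lambda>q. G (q, \<omega>)) \<longlongrightarrow> 0) at_bot"
    and osc: "\<And>q \<sigma>. norm \<sigma> = 1 \<Longrightarrow> \<bar>dd (1, 0) G (q, \<sigma>) - dd (1, 0) G (q, \<omega>)\<bar> \<le> C / jb q ^ 3"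
  shows "((\<lambda>r. r * free_wave G (r - q, r *\<^sub>R \<omega>)) \<longlongrightarrow> 2 * pi * G (q, \<omega>)) at_top"
proof -
  define h where "h = dd (1, 0) G"
  have h: "C_inf_on (UNIV \<times> (UNIV - {0})) h"
    unfolding h_def by (rule C_inf_dd[OF G]) (rule Basis_PairI)
  \<comment> \<open>The argument x . \<sigma> - t of the profile at the point
    \<open>(r - q, r *\<^sub>R \<omega>)\<close>, as a function of
    \<open>s = \<omega> \<bullet> \<sigma>\<close>.\<close>
  define Q where "Q = (\<lambda>r s. r * s - r + q)"
  have [simp]: "\<omega> \<noteq> 0" using \<omega> by auto
  define b where "b = (\<lambda>r. r * sphere_integral (\<lambda>\<sigma>. h (Q r (\<omega> \<bullet> \<sigma>), \<sigma>) - h (Q r (\<omega> \<bullet> \<sigma>), \<omega>)))"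
  have cQ: "continuous_on S (\<lambda>\<sigma>. Q r (\<omega> \<bullet> \<sigma>))" for r S unfolding Q_def by (intro continuous_intros)
  have c1: "continuous_on (sphere 0 1) (\<lambda>\<sigma>. h (Q r (\<omega> \<bullet> \<sigma>), \<sigma>))" for r
    by (rule continuous_on_compose2[OF C_inf_continuous[OF h]]) (auto intro!: continuous_intros cQ)
  have c2: "continuous_on (sphere 0 1) (\<lambda>\<sigma>. h (Q r (\<omega> \<bullet> \<sigma>), \<omega>))" for r
    by (rule continuous_on_compose2[OF C_inf_continuous[OF h]]) (auto intro!: continuous_intros cQ)
  have main: "r * free_wave G (r - q, r *\<^sub>R \<omega>) = 2 * pi * (G (q, \<omega>) - G (q - 2 * r, \<omega>)) + b r" for r
  proof -
    have "free_wave G (r - q, r *\<^sub>R \<omega>) = sphere_integral (\<lambda>\<sigma>. h (Q r (\<omega> \<bullet> \<sigma>), \<sigma>))"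
      unfolding free_wave_def h_def Q_def by (simp add: inner_commute algebra_simps)
    also have "\<dots> = sphere_integral (\<lambda>\<sigma>. h (Q r (\<omega> \<bullet> \<sigma>), \<omega>)) + sphere_integral (\<lambda>\<sigma>. h (Q r (\<omega> \<bullet> \<sigma>), \<sigma>) - h (Q r (\<omega> \<bullet> \<sigma>), \<omega>))"
      by (subst sphere_integral_add[symmetric]) (auto intro!: c1 c2 continuous_intros)
    finally have "r * free_wave G (r - q, r *\<^sub>R \<omega>) = sphere_integral (\<lambda>\<sigma>. r * h (Q r (\<omega> \<bullet> \<sigma>), \<omega>)) + b r"
      by (simp add: b_def sphere_integral_cmult algebra_simps)
    also have "sphere_integral (\<lambda>\<sigma>. r * h (Q r (\<omega> \<bullet> \<sigma>), \<omega>)) = 2 * pi * (G (Q r 1, \<omega>) - G (Q r (-1), \<omega>))"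
    proof (rule sphere_integral_zonal[OF _ _ \<omega>, where g = "\<lambda>s. r * h (Q r s, \<omega>)" and f = "\<lambda>s. G (Q r s, \<omega>)"])
      show "C_inf_on UNIV (\<lambda>s. r * h (Q r s, \<omega>))"
        by (intro C_inf_mult C_inf_const open_UNIV C_inf_compose_real[OF open_UNIV C_inf_slice[OF h]])
           (auto simp: Q_def intro!: C_inf_intros)
      fix s
      have "((\<lambda>q. G (q, \<omega>)) has_real_derivative dd 1 (\<lambda>q. G (q, \<omega>)) (Q r s)) (at (Q r s))"
        by (intro has_real_derivative_dd C_inf_differentiable[OF C_inf_slice[OF G]]) auto
      then have "((\<lambda>q. G (q, \<omega>)) has_real_derivative h (Q r s, \<omega>)) (at (Q r s))"
        by (simp add: dd_Pair_left h_def)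
      moreover have "(Q r has_real_derivative r) (at s)"
        unfolding Q_def by (auto intro!: derivative_eq_intros)
      ultimately show "((\<lambda>s. G (Q r s, \<omega>)) has_real_derivative r * h (Q r s, \<omega>)) (at s)"
        by (subst mult.commute) (rule DERIV_chain2)
    qed
    finally show ?thesis by (simp add: Q_def)
  qed
  have "filterlim (\<lambda>r. q - 2 * r) at_bot at_top"
    unfolding filterlim_at_bot
  proof
    fix Z show "\<forall>\<^sub>F r in at_top. q - 2 * r \<le> Z"
      using eventually_ge_at_top[of "(q - Z) / 2"] by eventually_elim (simp add: field_simps)
  qed
  then have lim1: "((\<lambda>r. G (q - 2 * r, \<omega>)) \<longlongrightarrow> 0) at_top"
    by (rule filterlim_compose[OF lim])
  have small: "\<forall>\<^sub>F r in at_top. \<forall>\<sigma>. norm \<sigma> = 1 \<longrightarrow>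
      \<bar>h (Q r (\<omega> \<bullet> \<sigma>), \<sigma>) - h (Q r (\<omega> \<bullet> \<sigma>), \<omega>)\<bar> \<le> \<epsilon> * (1 / (1 + (Q r (\<omega> \<bullet> \<sigma>))\<^sup>2))"
    if \<epsilon>: "\<epsilon> > 0" for \<epsilon>
  proof -
    \<comment> \<open>Beyond \<open>A\<close> one of the three powers of \<open>jb\<close> in
      \<open>osc\<close> already supplies the factor \<epsilon>; the other two give the integrable
      weight.\<close>
    define A where "A = \<bar>C\<bar> / \<epsilon> + 1"
    have A: "A > 0" "C / A \<le> \<epsilon>"
    proof -
      show "A > 0" using \<epsilon> by (simp add: A_def add_nonneg_pos)
      have "C \<le> \<epsilon> * A" using \<epsilon> by (simp add: A_def algebra_simps)
      then show "C / A \<le> \<epsilon>" using \<open>A > 0\<close> by (simp add: divide_le_eq)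
    qed
    have "uniformly_continuous_on ({-A..A} \<times> sphere 0 1) h"
      by (intro compact_uniformly_continuous compact_Times continuous_on_subset[OF C_inf_continuous[OF h]]) auto
    moreover have "\<epsilon> / (1 + A\<^sup>2) > 0" using \<epsilon> by (simp add: add_pos_nonneg)
    ultimately obtain \<delta> where \<delta>: "\<delta> > 0"
      and uc: "\<And>y z. y \<in> {-A..A} \<times> sphere 0 1 \<Longrightarrow> z \<in> {-A..A} \<times> sphere 0 1 \<Longrightarrow> dist z y < \<delta> \<Longrightarrow> dist (h z) (h y) < \<epsilon> / (1 + A\<^sup>2)"
      unfolding uniformly_continuous_on_def by metis
    \<comment> \<open>If the retarded argument q' is at most \<open>A\<close> in modulus, the
      squared distance of \<sigma> from \<omega> is 2 (q - q') / r, at most 2 (|q| + A) / r; the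
      threshold pushes it below the square of \<delta>.\<close>
    have "\<forall>\<^sub>F r in at_top. r > max 1 (2 * (\<bar>q\<bar> + A) / \<delta>\<^sup>2)" by (rule eventually_gt_at_top)
    then show ?thesis
    proof eventually_elim
      fix r assume r: "r > max 1 (2 * (\<bar>q\<bar> + A) / \<delta>\<^sup>2)"
      show "\<forall>\<sigma>. norm \<sigma> = 1 \<longrightarrow>
        \<bar>h (Q r (\<omega> \<bullet> \<sigma>), \<sigma>) - h (Q r (\<omega> \<bullet> \<sigma>), \<omega>)\<bar> \<le> \<epsilon> * (1 / (1 + (Q r (\<omega> \<bullet> \<sigma>))\<^sup>2))"
      proof (intro allI impI)
        fix \<sigma> :: "real^3" assume \<sigma>: "norm \<sigma> = 1"
        let ?q = "Q r (\<omega> \<bullet> \<sigma>)"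
        show "\<bar>h (?q, \<sigma>) - h (?q, \<omega>)\<bar> \<le> \<epsilon> * (1 / (1 + ?q\<^sup>2))"
        proof (cases "\<bar>?q\<bar> \<le> A")
          case True
          have "r * (1 - \<omega> \<bullet> \<sigma>) = q - ?q" by (simp add: Q_def algebra_simps)
          also have "\<dots> \<le> \<bar>q\<bar> + A" using True by linarith
          finally have "r * (2 * (1 - \<omega> \<bullet> \<sigma>)) \<le> 2 * (\<bar>q\<bar> + A)" by (simp add: algebra_simps)
          also have "\<dots> < r * \<delta>\<^sup>2" using r \<delta> by (simp add: divide_less_eq)
          finally have "2 * (1 - \<omega> \<bullet> \<sigma>) < \<delta>\<^sup>2" using r by simp
          moreover have "(norm (\<sigma> - \<omega>))\<^sup>2 = 2 * (1 - \<omega> \<bullet> \<sigma>)"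
            using \<sigma> \<omega> dot_norm_neg[of \<sigma> \<omega>] by (simp add: inner_commute[of \<omega>] field_simps)
          ultimately have "(norm (\<sigma> - \<omega>))\<^sup>2 < \<delta>\<^sup>2" by simp
          then have "norm (\<sigma> - \<omega>) < \<delta>" by (rule power_less_imp_less_base) (use \<delta> in simp)
          then have "dist (h (?q, \<sigma>)) (h (?q, \<omega>)) < \<epsilon> / (1 + A\<^sup>2)"
            using True \<sigma> \<omega> by (intro uc) (auto simp: dist_Pair_Pair dist_norm)
          also have "\<dots> \<le> \<epsilon> / (1 + ?q\<^sup>2)"
            using True \<epsilon> by (intro divide_left_mono) (auto simp: add_pos_nonneg abs_le_square_iff[symmetric] intro!: mult_pos_pos)
          finally show ?thesis by (simp add: dist_real_def)
        next
          case False
          have "C \<ge> 0" using osc[OF \<omega>, of 0] by (simp add: jb_def)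
          have "\<bar>h (?q, \<sigma>) - h (?q, \<omega>)\<bar> \<le> C / jb ?q ^ 3" unfolding h_def by (rule osc[OF \<sigma>])
          also have "\<dots> = (C / jb ?q) * (1 / (1 + ?q\<^sup>2))" by (simp only: jb_sq[symmetric]) (simp add: power2_eq_square power3_eq_cube)
          also have "C / jb ?q \<le> C / A"
            using False jb_ge_abs[of ?q] A \<open>C \<ge> 0\<close> by (intro divide_left_mono mult_pos_pos) auto
          then have "(C / jb ?q) * (1 / (1 + ?q\<^sup>2)) \<le> \<epsilon> * (1 / (1 + ?q\<^sup>2))"
            using A by (intro mult_right_mono) auto
          finally show ?thesis .
        qed
      qed
    qed
  qed
  have "(b \<longlongrightarrow> 0) at_top"
  proof (rule tendstoI)
    fix e :: real assume e: "e > 0"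
    \<comment> \<open>Two arctan values differ by less than pi, so the weight contributes less than
      2 pi^2 and the bound for \<open>b r\<close> is below e / 2.\<close>
    define \<epsilon> where "\<epsilon> = e / (4 * pi\<^sup>2)"
    have \<epsilon>: "\<epsilon> > 0" using e by (simp add: \<epsilon>_def)
    show "\<forall>\<^sub>F r in at_top. dist (b r) 0 < e"
      using small[OF \<epsilon>] eventually_gt_at_top[of 0]
    proof eventually_elim
      fix r :: real assume *: "\<forall>\<sigma>. norm \<sigma> = 1 \<longrightarrow>
        \<bar>h (Q r (\<omega> \<bullet> \<sigma>), \<sigma>) - h (Q r (\<omega> \<bullet> \<sigma>), \<omega>)\<bar> \<le> \<epsilon> * (1 / (1 + (Q r (\<omega> \<bullet> \<sigma>))\<^sup>2))" and r: "0 < r"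
      have nz: "1 + x\<^sup>2 \<noteq> 0" for x :: real using sum_power2_gt_zero_iff[of 1 x] by (simp)
      have "\<bar>sphere_integral (\<lambda>\<sigma>. h (Q r (\<omega> \<bullet> \<sigma>), \<sigma>) - h (Q r (\<omega> \<bullet> \<sigma>), \<omega>))\<bar> \<le>
        sphere_integral (\<lambda>\<sigma>. \<epsilon> * (1 / (1 + (Q r (\<omega> \<bullet> \<sigma>))\<^sup>2)))"
        by (rule sphere_integral_bound) (use * nz in \<open>auto intro!: continuous_intros c1 c2 cQ\<close>)
      then have "\<bar>b r\<bar> \<le> r * (\<epsilon> * sphere_integral (\<lambda>\<sigma>. 1 / (1 + (Q r (\<omega> \<bullet> \<sigma>))\<^sup>2)))"
        unfolding sphere_integral_cmult using r by (simp add: b_def abs_mult)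
      also have "\<dots> = \<epsilon> * sphere_integral (\<lambda>\<sigma>. r * (1 / (1 + (Q r (\<omega> \<bullet> \<sigma>))\<^sup>2)))"
        by (simp only: sphere_integral_cmult) (simp add: mult_ac)
      also have "sphere_integral (\<lambda>\<sigma>. r * (1 / (1 + (Q r (\<omega> \<bullet> \<sigma>))\<^sup>2))) = 2 * pi * (arctan (Q r 1) - arctan (Q r (-1)))"
      proof (rule sphere_integral_zonal[OF _ _ \<omega>, where g = "\<lambda>s. r * (1 / (1 + (Q r s)\<^sup>2))" and f = "\<lambda>s. arctan (Q r s)"])
        show "C_inf_on UNIV (\<lambda>s. r * (1 / (1 + (Q r s)\<^sup>2)))"
          unfolding Q_def by (intro C_inf_divide C_inf_intros open_UNIV nz)
        show "((\<lambda>s. arctan (Q r s)) has_real_derivative r * (1 / (1 + (Q r s)\<^sup>2))) (at s)" for s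
          by (auto intro!: derivative_eq_intros simp: Q_def divide_inverse)
      qed
      also have "\<epsilon> * \<dots> < \<epsilon> * (2 * pi * pi)"
        using arctan_bounded[of "Q r 1"] arctan_bounded[of "Q r (-1)"] \<epsilon> by simp
      also have "\<epsilon> * (2 * pi * pi) \<le> e" using e by (simp add: \<epsilon>_def power2_eq_square)
      finally show "dist (b r) 0 < e" by simp
    qed
  qed
  then have "((\<lambda>r. 2 * pi * (G (q, \<omega>) - G (q - 2 * r, \<omega>)) + b r) \<longlongrightarrow> 2 * pi * (G (q, \<omega>) - 0) + 0) at_top"
    by (intro tendsto_intros lim1)
  then show ?thesis unfolding main by simp
qed

section \<open>The advanced potential of a source\<close>

lemma dd_translate: "dd v (\<lambda>p. F (p + a)) p = dd v F (p + a)"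
  unfolding dd_def by (simp add: algebra_simps)

lemma box_translate: "box (\<lambda>p. F (p + a)) p = box F (p + a)"
proof -
  have "dd v (\<lambda>p. F (p + a)) = (\<lambda>p. dd v F (p + a))" for v
    by (rule ext) (rule dd_translate)
  then show ?thesis by (simp add: box_def dd_translate[of _ "dd _ F"])
qed

lemma box_linear:
  assumes f: "C_inf_on UNIV f" and g: "C_inf_on UNIV g"
  shows "box (\<lambda>p. a * f p + b * g p) p = a * box f p + b * box g p"
proof -
  have "dd v (dd v (\<lambda>p. a * f p + b * g p)) p = a * dd v (dd v f) p + b * dd v (dd v g) p" if v: "v \<in> Basis" for v
  proof -
    note d = C_inf_differentiable[OF f UNIV_I] C_inf_differentiable[OF g UNIV_I]
      C_inf_differentiable[OF C_inf_dd[OF f v] UNIV_I] C_inf_differentiable[OF C_inf_dd[OF g v] UNIV_I]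
    have "dd v (\<lambda>p. a * f p + b * g p) = (\<lambda>p. a * dd v f p + b * dd v g p)"
      by (rule ext) (simp add: dd_add dd_cmult d differentiable_mult)
    then show ?thesis by (simp add: dd_add dd_cmult d differentiable_mult)
  qed
  then show ?thesis
    by (simp add: box_def Basis_PairI sum.distrib sum_distrib_left algebra_simps)
qed

lemma box_cmult:
  assumes f: "C_inf_on UNIV f" shows "box (\<lambda>p. c * f p) p = c * box f p"
  using box_linear[OF f f, of c 0 p] by simp

section \<open>The source and its integral over the forward light cone\<close>

locale wave_source =
  fixes g :: "real \<times> (real^3) \<Rightarrow> real" and chi :: "real \<Rightarrow> real"
  assumes g_smooth: "C_inf_on (UNIV \<times> (UNIV - {0})) g"
    and g_homogeneous: "\<And>c q x. c > 0 \<Longrightarrow> g (q, c *\<^sub>R x) = g (q, x)"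
    and chi_smooth: "C_inf_on UNIV chi"
    and chi_0: "\<And>s. s > 1/2 \<Longrightarrow> chi s = 0"
begin

definition source :: "real \<times> (real^3) \<Rightarrow> real" where
  "source p = g (norm (snd p) - fst p, snd p) / norm (snd p) ^ 3 * chi (jb (fst p - norm (snd p)) / norm (snd p))"

definition ret :: "(real \<times> (real^3)) \<times> real \<Rightarrow> real^3 \<Rightarrow> real" where
  "ret pz \<sigma> = (snd pz * (snd (fst pz) \<bullet> snd (fst pz)) + 2 * (snd (fst pz) \<bullet> \<sigma>)) /
     (norm (snd pz *\<^sub>R snd (fst pz) + \<sigma>) + norm \<sigma>) - fst (fst pz)"

text \<open>The source at the point \<open>\<sigma> / z\<close> of the forward light cone with vertex \<open>p\<close>, rescaled by \<open>z\<^sup>-\<^sup>3\<close>;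
  \<open>ret\<close> is the rationalised form of \<open>r - t\<close> at that point, so that this stays smooth up to \<open>z = 0\<close>.\<close>

definition tail :: "((real \<times> (real^3)) \<times> real) \<times> (real^3) \<Rightarrow> real" where
  "tail q = g (ret (fst q) (snd q), snd (fst q) *\<^sub>R snd (fst (fst q)) + snd q) /
     norm (snd (fst q) *\<^sub>R snd (fst (fst q)) + snd q) ^ 3 *
     chi (snd (fst q) * jb (ret (fst q) (snd q)) / norm (snd (fst q) *\<^sub>R snd (fst (fst q)) + snd q))"

text \<open>The singular axis is invisible: since \<open>jb >= 1\<close>, the argument of the cutoff
  exceeds 1/2 whenever 0 < |x| < 2, and at x = 0 division by zero yields 0. Hence the source
  vanishes identically on a neighbourhood of the axis.\<close>

lemma C_inf_source: "C_inf_on UNIV source"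
proof -
  let ?U = "UNIV \<times> (UNIV - {0}) :: (real \<times> (real^3)) set" and ?V = "{p :: real \<times> (real^3). norm (snd p) < 2}"
  have n: "C_inf_on ?U (\<lambda>p. norm (snd p))"
    by (rule C_inf_norm[OF open_punctured]) (auto intro!: C_inf_linear_intros)
  have "C_inf_on ?U source" unfolding source_def
    by (intro C_inf_mult C_inf_divide C_inf_power n open_punctured
        C_inf_compose_Pair[OF open_punctured g_smooth] C_inf_compose_real[OF open_punctured chi_smooth]
        C_inf_jb C_inf_diff C_inf_linear_intros) auto
  moreover have "C_inf_on ?V source"
  proof (rule C_inf_cong[of _ _ "\<lambda>_. 0"])
    show "open ?V" by (intro open_Collect_less continuous_intros)
    fix p :: "real \<times> (real^3)" assume p: "p \<in> ?V"
    show "source p = 0"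
    proof (cases "snd p = 0")
      case False
      then have "jb (fst p - norm (snd p)) / norm (snd p) > 1 / 2"
        using p jb_ge_1[of "fst p - norm (snd p)"] by (simp add: less_divide_eq)
      then show ?thesis by (simp add: source_def chi_0)
    qed (simp add: source_def)
  qed simp
  ultimately have "C_inf_on (?U \<union> ?V) source" by (rule C_inf_Un)
  then show ?thesis by (rule C_inf_subset) auto
qed

text \<open>With y = z x + \<sigma>, the difference of squares |y|^2 - |\<sigma>|^2 has a factor z.
  Dividing it out removes the cancellation between the two large numbers |y| / z and |\<sigma>| / z
  and produces \<open>ret\<close>; homogeneity of \<open>g\<close> replaces y / z by y, and the cube
  of the norm gives the power of z.\<close>

lemma tail_eq_source:
  assumes z: "z > 0" and \<sigma>: "\<sigma> \<noteq> 0"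
  shows "tail ((p, z), \<sigma>) = source (fst p + norm \<sigma> / z, snd p + (1 / z) *\<^sub>R \<sigma>) / z ^ 3"
proof -
  obtain t x where p: "p = (t, x)" by (cases p)
  define y where "y = z *\<^sub>R x + \<sigma>"
  have xy: "x + (1 / z) *\<^sub>R \<sigma> = (1 / z) *\<^sub>R y" using z by (simp add: y_def algebra_simps)
  have nxy: "norm ((1 / z) *\<^sub>R y) = norm y / z" using z by simp
  have pos: "norm y + norm \<sigma> > 0" using \<sigma> by (simp add: add_nonneg_pos)
  have "(norm y)\<^sup>2 = z * (z * (x \<bullet> x) + 2 * (x \<bullet> \<sigma>)) + (norm \<sigma>)\<^sup>2"
    by (simp add: y_def power2_norm_eq_inner inner_commute[of \<sigma> x] algebra_simps)
  then have "(norm y - norm \<sigma>) * (norm y + norm \<sigma>) = z * (z * (x \<bullet> x) + 2 * (x \<bullet> \<sigma>))"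
    by (simp add: algebra_simps power2_eq_square)
  then have "norm y / z - norm \<sigma> / z = (z * (x \<bullet> x) + 2 * (x \<bullet> \<sigma>)) / (norm y + norm \<sigma>)"
    using pos z by (simp add: field_simps)
  then have q: "norm y / z - (t + norm \<sigma> / z) = ret (p, z) \<sigma>"
    by (simp add: ret_def p y_def)
  have jb: "jb (t + norm \<sigma> / z - norm y / z) = jb (ret (p, z) \<sigma>)"
    using q unfolding jb_def by (simp add: power2_commute)
  have "source (fst p + norm \<sigma> / z, snd p + (1 / z) *\<^sub>R \<sigma>) =
    g (ret (p, z) \<sigma>, (1 / z) *\<^sub>R y) / (norm y / z) ^ 3 * chi (jb (ret (p, z) \<sigma>) / (norm y / z))"
    unfolding source_def p fst_conv snd_conv xy nxy by (simp only: q[unfolded p] jb[unfolded p])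
  also have "g (ret (p, z) \<sigma>, (1 / z) *\<^sub>R y) = g (ret (p, z) \<sigma>, y)"
    using z by (intro g_homogeneous) simp
  finally show ?thesis
    using z by (simp add: tail_def p y_def[symmetric] power_divide mult.commute)
qed

text \<open>Two open regions of smoothness overlap here. Where z x + \<sigma> is nonzero the
  explicit formula is smooth, also for z <= 0; where z > 0 smoothness comes from
  \<open>source\<close>, which is smooth across the axis z x + \<sigma> = 0.\<close>

definition tail_dom :: "(((real \<times> (real^3)) \<times> real) \<times> (real^3)) set" where
  "tail_dom = {q. snd q \<noteq> 0 \<and> (snd (fst q) > 0 \<or> snd (fst q) *\<^sub>R snd (fst (fst q)) + snd q \<noteq> 0)}"

lemma C_inf_tail: "C_inf_on tail_dom tail"
proof -
  let ?W1 = "{q :: ((real \<times> (real^3)) \<times> real) \<times> (real^3). snd q \<noteq> 0 \<and> snd (fst q) *\<^sub>R snd (fst (fst q)) + snd q \<noteq> 0}"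
  let ?W2 = "{q :: ((real \<times> (real^3)) \<times> real) \<times> (real^3). snd q \<noteq> 0 \<and> snd (fst q) > 0}"
  have o1: "open ?W1" by (intro open_Collect_conj open_Collect_neq continuous_intros)
  have o2: "open ?W2" by (intro open_Collect_conj open_Collect_neq open_Collect_less continuous_intros)
  have lin: "C_inf_on W (\<lambda>q :: ((real \<times> (real^3)) \<times> real) \<times> (real^3). snd (fst (fst q)) \<bullet> b)"
    "C_inf_on W (\<lambda>q :: ((real \<times> (real^3)) \<times> real) \<times> (real^3). fst (fst (fst q)))"
    "C_inf_on W (\<lambda>q :: ((real \<times> (real^3)) \<times> real) \<times> (real^3). snd (fst q))"
    "C_inf_on W (\<lambda>q :: ((real \<times> (real^3)) \<times> real) \<times> (real^3). snd q \<bullet> b)" for W and b :: "real^3"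
    by (rule C_inf_bounded_linear, intro bounded_linear_intros)+
  have y: "C_inf_on W (\<lambda>q :: ((real \<times> (real^3)) \<times> real) \<times> (real^3). (snd (fst q) *\<^sub>R snd (fst (fst q)) + snd q) \<bullet> b)"
    if "open W" for W and b :: "real^3"
    unfolding inner_add_left inner_scaleR_left by (intro C_inf_add C_inf_mult lin that)
  have ny: "C_inf_on ?W1 (\<lambda>q. norm (snd (fst q) *\<^sub>R snd (fst (fst q)) + snd q))"
    by (intro C_inf_norm y o1) auto
  have ns: "C_inf_on W (\<lambda>q :: ((real \<times> (real^3)) \<times> real) \<times> (real^3). norm (snd q))"
    if "open W" "\<And>q. q \<in> W \<Longrightarrow> snd q \<noteq> 0" for W
    by (rule C_inf_norm[OF that(1) lin(4) that(2)])
  have r: "C_inf_on ?W1 (\<lambda>q. ret (fst q) (snd q))"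
    unfolding ret_def
    by (intro C_inf_diff C_inf_divide C_inf_add C_inf_mult C_inf_const C_inf_inner[OF o1 lin(1) lin(1)]
        C_inf_inner[OF o1 lin(1) lin(4)] lin(2,3) ny ns[OF o1] o1)
       (auto simp: add_nonneg_eq_0_iff)
  have "C_inf_on ?W1 tail" unfolding tail_def
    by (intro C_inf_mult C_inf_divide C_inf_power C_inf_compose_Pair[OF o1 g_smooth]
        C_inf_compose_real[OF o1 chi_smooth] C_inf_jb r ny y lin o1) auto
  moreover have "C_inf_on ?W2 tail"
  proof (rule C_inf_cong[OF o2])
    show "tail q = source (fst (fst (fst q)) + norm (snd q) / snd (fst q), snd (fst (fst q)) + (1 / snd (fst q)) *\<^sub>R snd q) / snd (fst q) ^ 3"
      if "q \<in> ?W2" for q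
      using tail_eq_source[of "snd (fst q)" "snd q" "fst (fst q)"] that by simp
    have "C_inf_on ?W2 (\<lambda>q. source (fst (fst (fst q)) + norm (snd q) / snd (fst q), snd (fst (fst q)) + (1 / snd (fst q)) *\<^sub>R snd q))"
    proof (rule C_inf_compose_Pair[OF o2 C_inf_source])
      show "C_inf_on ?W2 (\<lambda>q. fst (fst (fst q)) + norm (snd q) / snd (fst q))"
        by (intro C_inf_add C_inf_divide lin ns o2) auto
      show "C_inf_on ?W2 (\<lambda>q. (snd (fst (fst q)) + (1 / snd (fst q)) *\<^sub>R snd q) \<bullet> b)" for b
        unfolding inner_add_left inner_scaleR_left
        by (intro C_inf_add C_inf_mult C_inf_divide C_inf_const lin o2) auto
    qed simp
    then show "C_inf_on ?W2 (\<lambda>q. source (fst (fst (fst q)) + norm (snd q) / snd (fst q), snd (fst (fst q)) + (1 / snd (fst q)) *\<^sub>R snd q) / snd (fst q) ^ 3)"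
      by (intro C_inf_divide C_inf_power lin o2) auto
  qed
  ultimately have "C_inf_on (?W1 \<union> ?W2) tail" by (rule C_inf_Un)
  then show ?thesis by (rule C_inf_subset) (auto simp: tail_dom_def)
qed

definition near :: "(real \<times> (real^3)) \<times> real \<Rightarrow> real" where
  "near q = sphere_integral (\<lambda>\<sigma>. source (fst (fst q) + snd q, snd (fst q) + snd q *\<^sub>R \<sigma>))"

definition far :: "(real \<times> (real^3)) \<times> real \<Rightarrow> real" where
  "far q = sphere_integral (\<lambda>\<sigma>. tail (q, \<sigma>))"

text \<open>The weight \<rho> is the surface factor \<rho>^2 times the wave kernel 1 / \<rho>.
  Splitting at radius 1 leaves two integrals over compact intervals with smooth integrands, so no
  domination argument is needed when differentiating. The factor 1 only fits the shape of the
  parameter integrals above.\<close>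

definition potential :: "real \<times> (real^3) \<Rightarrow> real" where
  "potential p = integral (cbox 0 1) (\<lambda>\<rho>. \<rho> * near (p, \<rho>)) + integral (cbox 0 1) (\<lambda>z. 1 * far (p, z))"

text \<open>The light cone integral of \<open>\<rho> * near (p, \<rho>)\<close> over \<open>\<rho> > 1\<close> becomes the integral of \<open>far (p, z)\<close> over
  \<open>0 < z < 1\<close> under \<open>\<rho> = 1 / z\<close>.\<close>

definition far_dom :: "((real \<times> (real^3)) \<times> real) set" where
  "far_dom = {q. snd q > 0 \<or> \<bar>snd q\<bar> * norm (snd (fst q)) < 1}"

lemma far_dom_tail_dom:
  assumes "q \<in> far_dom" "norm \<sigma> = 1" shows "(q, \<sigma>) \<in> tail_dom"
proof -
  have "snd q *\<^sub>R snd (fst q) + \<sigma> \<noteq> 0" if "\<bar>snd q\<bar> * norm (snd (fst q)) < 1"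
  proof
    assume "snd q *\<^sub>R snd (fst q) + \<sigma> = 0"
    then have "norm (snd q *\<^sub>R snd (fst q)) = norm \<sigma>" by (metis add.commute add_eq_0_iff norm_minus_cancel)
    with that assms(2) show False by simp
  qed
  moreover have "\<sigma> \<noteq> 0" using assms(2) by auto
  ultimately show ?thesis using assms(1) by (auto simp: far_dom_def tail_dom_def)
qed

lemma open_far_dom: "open far_dom"
  unfolding far_dom_def by (intro open_Collect_disj open_Collect_less continuous_intros)

lemma C_inf_near: "C_inf_on UNIV near"
  unfolding near_def
proof (rule C_inf_sphere_integral[OF open_UNIV, where H = "\<lambda>q. source (fst (fst (fst q)) + snd (fst q), snd (fst (fst q)) + snd (fst q) *\<^sub>R snd q)" and W = UNIV, unfolded fst_conv snd_conv])
  have lin: "C_inf_on UNIV (\<lambda>q :: ((real \<times> (real^3)) \<times> real) \<times> (real^3). snd (fst (fst q)) \<bullet> b)"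
    "C_inf_on UNIV (\<lambda>q :: ((real \<times> (real^3)) \<times> real) \<times> (real^3). fst (fst (fst q)))"
    "C_inf_on UNIV (\<lambda>q :: ((real \<times> (real^3)) \<times> real) \<times> (real^3). snd (fst q))"
    "C_inf_on UNIV (\<lambda>q :: ((real \<times> (real^3)) \<times> real) \<times> (real^3). snd q \<bullet> b)" for b :: "real^3"
    by (rule C_inf_bounded_linear, intro bounded_linear_intros)+
  show "C_inf_on UNIV (\<lambda>q. source (fst (fst (fst q)) + snd (fst q), snd (fst (fst q)) + snd (fst q) *\<^sub>R snd q))"
    by (rule C_inf_compose_Pair[OF open_UNIV C_inf_source])
       (auto simp: inner_add_left intro!: C_inf_add C_inf_mult lin)
qed simp

lemma C_inf_far: "C_inf_on far_dom far"
  unfolding far_def by (rule C_inf_sphere_integral[OF open_far_dom C_inf_tail far_dom_tail_dom])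

lemma far_eq_near:
  assumes "z > 0" shows "far (p, z) = (1 / z ^ 3) * near (p, 1 / z)"
proof -
  have "far (p, z) = sphere_integral (\<lambda>\<sigma>. (1 / z ^ 3) * source (fst p + 1 / z, snd p + (1 / z) *\<^sub>R \<sigma>))"
    unfolding far_def
  proof (rule sphere_integral_cong)
    fix \<sigma> :: "real^3" assume \<sigma>: "norm \<sigma> = 1"
    then have "\<sigma> \<noteq> 0" by auto
    from tail_eq_source[OF assms this, of p] \<sigma>
    show "tail ((p, z), \<sigma>) = (1 / z ^ 3) * source (fst p + 1 / z, snd p + (1 / z) *\<^sub>R \<sigma>)" by simp
  qed
  then show ?thesis by (simp only: sphere_integral_cmult near_def fst_conv snd_conv)
qed

lemma far_dom_unit: "z \<in> cbox 0 1 \<Longrightarrow> (p, z) \<in> far_dom"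
  unfolding far_dom_def by (cases "z = 0") auto

lemma C_inf_potential: "C_inf_on UNIV potential"
  unfolding potential_def
  by (intro C_inf_add open_UNIV C_inf_param_integral[OF _ C_inf_near] C_inf_param_integral[OF _ C_inf_far])
     (auto simp: far_dom_unit[unfolded cbox_interval] intro!: continuous_intros)

lemma C_inf_near_slice: "C_inf_on UNIV (\<lambda>p. near (p, \<rho>))"
proof (rule C_inf_compose[OF open_UNIV C_inf_near])
  show "C_inf_on UNIV (\<lambda>p :: real \<times> (real^3). (p, \<rho>) \<bullet> b)" for b
    by (cases b) (simp only: inner_Pair, rule C_inf_add[OF open_UNIV C_inf_bounded_linear[OF bounded_linear_inner_left] C_inf_const])
qed simp

lemma box_near: "box (\<lambda>p. near (p, \<rho>)) p = sphere_integral (\<lambda>\<sigma>. box source (fst p + \<rho>, snd p + \<rho> *\<^sub>R \<sigma>))"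
proof -
  let ?H = "\<lambda>q. source (fst (fst q) + \<rho>, snd (fst q) + \<rho> *\<^sub>R snd q)"
  have H: "C_inf_on UNIV ?H"
    by (rule C_inf_compose_Pair[OF open_UNIV C_inf_source])
       (auto simp: inner_add_left intro!: C_inf_intros)
  have "box (\<lambda>p. near (p, \<rho>)) p = sphere_integral (\<lambda>\<sigma>. box (\<lambda>p. ?H (p, \<sigma>)) p)"
    using box_sphere_integral[OF open_UNIV H, of p] by (simp add: near_def)
  also have "\<dots> = sphere_integral (\<lambda>\<sigma>. box source (fst p + \<rho>, snd p + \<rho> *\<^sub>R \<sigma>))"
  proof (rule sphere_integral_cong)
    fix \<sigma> :: "real^3"
    have "(\<lambda>p. ?H (p, \<sigma>)) = (\<lambda>p. source (p + (\<rho>, \<rho> *\<^sub>R \<sigma>)))"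
      by (simp add: plus_prod_def)
    then show "box (\<lambda>p. ?H (p, \<sigma>)) p = box source (fst p + \<rho>, snd p + \<rho> *\<^sub>R \<sigma>)"
      using box_translate[of source "(\<rho>, \<rho> *\<^sub>R \<sigma>)" p] by (simp add: plus_prod_def)
  qed
  finally show ?thesis .
qed

text \<open>The Kirchhoff identity on \<open>\<rho> \<in> [0, 1]\<close> and on \<open>\<rho> \<in> [1, \<infinity>)\<close>; the boundary terms at \<open>\<rho> = 1\<close> cancel and
  the one at infinity vanishes because \<open>tail\<close> is smooth at \<open>z = 0\<close>.\<close>

lemma box_potential: "box potential (t, x) = - 4 * pi * source (t, x)"
proof -
  let ?k = "kirchhoff source t x"
  define p where "p = (t, x)"
  \<comment> \<open>The Kirchhoff mean at radius 1 / z, rewritten through \<open>tail\<close>. In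
    this form it makes sense and is continuous at z = 0, and the positive powers of z make it vanish
    there.\<close>
  define N where "N = (\<lambda>z. sphere_integral (\<lambda>\<sigma>. z ^ 3 * tail ((p, z), \<sigma>) +
    z\<^sup>2 * ((\<Sum>e\<in>Basis. (\<sigma> \<bullet> e) * dd (((0, e), 0), 0) tail ((p, z), \<sigma>)) - dd (((1, 0), 0), 0) tail ((p, z), \<sigma>))))"
  have dk: "(?k has_real_derivative \<rho> * box (\<lambda>p. near (p, \<rho>)) p) (at \<rho>)" for \<rho>
    using kirchhoff_deriv[OF C_inf_source, of t x \<rho>] by (simp add: box_near p_def)
  have bnear: "box (\<lambda>p. integral (cbox 0 1) (\<lambda>\<rho>. \<rho> * near (p, \<rho>))) p = ?k 1 - ?k 0"
  proof -
    have "box (\<lambda>p. integral (cbox 0 1) (\<lambda>\<rho>. \<rho> * near (p, \<rho>))) p =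
      integral (cbox 0 1) (\<lambda>\<rho>. \<rho> * box (\<lambda>p. near (p, \<rho>)) p)"
      by (rule box_param_integral[OF open_UNIV C_inf_near]) (auto intro!: continuous_intros)
    also have "\<dots> = ?k 1 - ?k 0"
      unfolding cbox_interval
      by (intro integral_unique fundamental_theorem_of_calculus)
         (auto simp: has_real_derivative_iff_has_vector_derivative[symmetric] intro!: DERIV_subset[OF dk])
    finally show ?thesis .
  qed
  have N: "N z = ?k (1 / z)" if z: "z > 0" for z
    unfolding N_def kirchhoff_def
  proof (rule sphere_integral_cong)
    fix \<sigma> :: "real^3" assume \<sigma>: "norm \<sigma> = 1"
    then have nz: "\<sigma> \<noteq> 0" by auto
    have eq: "(\<lambda>p. tail ((p, z), \<sigma>)) = (\<lambda>p. (1 / z ^ 3) * source (p + (1 / z, (1 / z) *\<^sub>R \<sigma>)))"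
      using tail_eq_source[OF z nz] \<sigma> by (simp add: plus_prod_def fun_eq_iff)
    have dt: "dd ((v, 0), 0) tail ((p, z), \<sigma>) = (1 / z ^ 3) * dd v source (p + (1 / z, (1 / z) *\<^sub>R \<sigma>))" for v
    proof -
      have "dd ((v, 0), 0) tail ((p, z), \<sigma>) = dd v (\<lambda>p. tail ((p, z), \<sigma>)) p"
        unfolding dd_def by simp
      also have "\<dots> = (1 / z ^ 3) * dd v (\<lambda>p. source (p + (1 / z, (1 / z) *\<^sub>R \<sigma>))) p"
        unfolding eq
      proof (rule dd_cmult)
        have "C_inf_on UNIV (\<lambda>p. source (p + (1 / z, (1 / z) *\<^sub>R \<sigma>)))"
          by (rule C_inf_compose[OF open_UNIV C_inf_source], simp,
              unfold inner_add_left, rule C_inf_add[OF open_UNIV C_inf_bounded_linear[OF bounded_linear_inner_left] C_inf_const])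
        then show "(\<lambda>p. source (p + (1 / z, (1 / z) *\<^sub>R \<sigma>))) differentiable (at p)"
          by (rule C_inf_differentiable) simp
      qed
      finally show ?thesis unfolding dd_translate[of v source "(1 / z, (1 / z) *\<^sub>R \<sigma>)" p] .
    qed
    have "tail ((p, z), \<sigma>) = (1 / z ^ 3) * source (p + (1 / z, (1 / z) *\<^sub>R \<sigma>))"
      using fun_cong[OF eq, of p] by simp
    then show "z ^ 3 * tail ((p, z), \<sigma>) +
      z\<^sup>2 * ((\<Sum>e\<in>Basis. (\<sigma> \<bullet> e) * dd (((0, e), 0), 0) tail ((p, z), \<sigma>)) - dd (((1, 0), 0), 0) tail ((p, z), \<sigma>)) =
      source (t + 1 / z, x + (1 / z) *\<^sub>R \<sigma>) + (1 / z) *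
      ((\<Sum>e\<in>Basis. (\<sigma> \<bullet> e) * dd (0, e) source (t + 1 / z, x + (1 / z) *\<^sub>R \<sigma>)) - dd (1, 0) source (t + 1 / z, x + (1 / z) *\<^sub>R \<sigma>))"
      using z unfolding dt
      by (simp add: p_def sum_distrib_left power2_eq_square power3_eq_cube right_diff_distrib field_simps)
  qed
  have contN: "continuous_on {0..1} N"
  proof -
    define H where "H = (\<lambda>q :: ((real \<times> (real^3)) \<times> real) \<times> (real^3). snd (fst q) ^ 3 * tail q + (snd (fst q))\<^sup>2 *
      ((\<Sum>e\<in>Basis. (snd q \<bullet> e) * dd (((0, e), 0), 0) tail q) - dd (((1, 0), 0), 0) tail q))"
    have dt: "C_inf_on tail_dom (dd ((v, 0), 0) tail)" if "v \<in> Basis" for v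
      by (rule C_inf_dd[OF C_inf_tail]) (use that in \<open>auto intro: Basis_PairI\<close>)
    have otd: "open tail_dom"
      unfolding tail_dom_def
      by (intro open_Collect_conj open_Collect_disj open_Collect_neq open_Collect_less continuous_intros)
    have lin: "C_inf_on tail_dom (\<lambda>q. snd (fst q))" "C_inf_on tail_dom (\<lambda>q. snd q \<bullet> b)" for b :: "real^3"
      by (rule C_inf_bounded_linear, intro bounded_linear_intros)+
    have "C_inf_on tail_dom H" unfolding H_def
      by (intro C_inf_add C_inf_mult C_inf_diff C_inf_sum C_inf_power otd lin C_inf_tail dt Basis_PairI; assumption)
    from C_inf_sphere_integral[OF open_far_dom this far_dom_tail_dom]
    have "continuous_on far_dom (\<lambda>q. sphere_integral (\<lambda>\<sigma>. H (q, \<sigma>)))" by (rule C_inf_continuous)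
    then have "continuous_on {0..1} (\<lambda>z. sphere_integral (\<lambda>\<sigma>. H ((p, z), \<sigma>)))"
      by (rule continuous_on_compose2) (auto intro!: continuous_intros simp: far_dom_unit[unfolded cbox_interval])
    then show ?thesis by (simp add: N_def H_def)
  qed
  have bfar: "box (\<lambda>p. integral (cbox 0 1) (\<lambda>z. 1 * far (p, z))) p = - ?k 1"
  proof -
    have "box (\<lambda>p. integral (cbox 0 1) (\<lambda>z. 1 * far (p, z))) p = integral (cbox 0 1) (\<lambda>z. 1 * box (\<lambda>p. far (p, z)) p)"
      by (rule box_param_integral[OF open_UNIV C_inf_far]) (auto intro: far_dom_unit[unfolded cbox_interval])
    also have "\<dots> = (- N 1) - (- N 0)"
      unfolding cbox_interval
    \<comment> \<open>\<open>N\<close> is identified with the Kirchhoff mean, and hence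
      differentiated, only for z > 0; at the endpoint 0 continuity suffices.\<close>
    proof (intro integral_unique fundamental_theorem_of_calculus_interior)
      show "continuous_on {0..1} (\<lambda>z. - N z)" by (intro continuous_intros contN)
      fix z :: real assume "z \<in> {0<..<1}"
      then have z: "z > 0" by simp
      have "(\<lambda>p. far (p, z)) = (\<lambda>p. (1 / z ^ 3) * near (p, 1 / z))" by (rule ext) (rule far_eq_near[OF z])
      then have bz: "box (\<lambda>p. far (p, z)) p = (1 / z ^ 3) * box (\<lambda>p. near (p, 1 / z)) p"
        by (simp only: box_cmult[OF C_inf_near_slice])
      \<comment> \<open>The chain rule factor 1 / z^2 and the radius 1 / z in the Kirchhoff
        derivative combine to the factor 1 / z^3 that relates \<open>far\<close> to
        \<open>near\<close>.\<close>
      have "((\<lambda>z. 1 / z) has_real_derivative - (1 / z\<^sup>2)) (at z)"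
        using z by (auto intro!: derivative_eq_intros simp: power2_eq_square)
      from DERIV_minus[OF DERIV_chain2[OF dk this]]
      have "((\<lambda>z. - ?k (1 / z)) has_real_derivative 1 * box (\<lambda>p. far (p, z)) p) (at z)"
        by (rule DERIV_cong) (use z in \<open>simp add: bz power2_eq_square power3_eq_cube\<close>)
      then have "((\<lambda>z. - N z) has_real_derivative 1 * box (\<lambda>p. far (p, z)) p) (at z)"
        by (rule DERIV_cong_ev[THEN iffD1, rotated 3])
           (use z in \<open>auto intro!: eventually_nhds_in_open[of "{0<..}", THEN eventually_mono] simp: N\<close>)
      then show "((\<lambda>z. - N z) has_vector_derivative 1 * box (\<lambda>p. far (p, z)) p) (at z)"
        by (simp add: has_real_derivative_iff_has_vector_derivative)
    qed simp
    also have "N 0 = 0" by (simp add: N_def sphere_integral_const)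
    finally show ?thesis by (simp add: N)
  qed
  have "box potential p = box (\<lambda>p. integral (cbox 0 1) (\<lambda>\<rho>. \<rho> * near (p, \<rho>))) p + box (\<lambda>p. integral (cbox 0 1) (\<lambda>z. 1 * far (p, z))) p"
    using box_linear[of "\<lambda>p. integral (cbox 0 1) (\<lambda>\<rho>. \<rho> * near (p, \<rho>))" "\<lambda>p. integral (cbox 0 1) (\<lambda>z. 1 * far (p, z))" 1 1 p,
        OF C_inf_param_integral[OF open_UNIV C_inf_near] C_inf_param_integral[OF open_UNIV C_inf_far]]
    by (simp add: potential_def[abs_def] far_dom_unit[unfolded cbox_interval])
  then show ?thesis using bnear bfar by (simp add: kirchhoff_0 p_def)
qed

end

section \<open>The radiation field of the potential\<close>

lemma integral_inverse_square:
  fixes t :: real assumes "t > 0"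
  shows "((\<lambda>z. 1 / (1 + z * t)\<^sup>2) has_integral 1 / (1 + t)) {0..1}"
proof -
  have "((\<lambda>z. 1 / (1 + z * t)\<^sup>2) has_integral - 1 / (t * (1 + 1 * t)) - - 1 / (t * (1 + 0 * t))) {0..1}"
  proof (rule fundamental_theorem_of_calculus)
    fix z :: real assume "z \<in> {0..1}"
    then have nz: "1 + z * t > 0" using assms by (intro add_pos_nonneg) auto
    show "((\<lambda>z. - 1 / (t * (1 + z * t))) has_vector_derivative 1 / (1 + z * t)\<^sup>2) (at z within {0..1})"
      unfolding has_real_derivative_iff_has_vector_derivative[symmetric]
      using assms nz by (auto intro!: derivative_eq_intros simp: power2_eq_square)
  qed simp
  moreover have "- 1 / (t * (1 + 1 * t)) - - 1 / (t * (1 + 0 * t)) = 1 / (1 + t)"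
  proof -
    have "t + t * t > 0" using assms by (simp add: add_pos_pos)
    then show ?thesis using assms by (simp add: field_simps)
  qed
  ultimately show ?thesis by simp
qed

text \<open>Archimedes' theorem with a primitive built from arctan, whose total increase is at most
  pi / (2 c). The gain 1 / c measures the cap around \<omega> on which the kernel
  concentrates.\<close>

lemma sphere_integral_cauchy_kernel:
  assumes \<omega>: "norm \<omega> = 1" and c: "c > 0"
  shows "sphere_integral (\<lambda>\<sigma>. 1 / (1 + (c * (1 - \<omega> \<bullet> \<sigma>))\<^sup>2)) \<le> pi\<^sup>2 / c"
proof -
  have nz: "1 + (c * (1 - s))\<^sup>2 \<noteq> 0" for s
    by (metis add_pos_nonneg less_irrefl zero_less_one zero_le_power2)
  have "sphere_integral (\<lambda>\<sigma>. 1 / (1 + (c * (1 - \<omega> \<bullet> \<sigma>))\<^sup>2)) =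
    2 * pi * (- arctan (c * (1 - 1)) / c - - arctan (c * (1 - (- 1))) / c)"
  proof (rule sphere_integral_zonal[OF _ _ \<omega>, where g = "\<lambda>s. 1 / (1 + (c * (1 - s))\<^sup>2)" and f = "\<lambda>s. - arctan (c * (1 - s)) / c"])
    show "C_inf_on UNIV (\<lambda>s. 1 / (1 + (c * (1 - s))\<^sup>2))"
      by (intro C_inf_divide C_inf_intros open_UNIV nz)
    show "((\<lambda>s. - arctan (c * (1 - s)) / c) has_real_derivative 1 / (1 + (c * (1 - s))\<^sup>2)) (at s)" for s
      using c nz by (auto intro!: derivative_eq_intros simp: divide_inverse)
  qed
  also have "\<dots> \<le> 2 * pi * ((pi / 2) / c)"
  proof -
    have "arctan (c * 2) / c \<le> pi / 2 / c"
      using arctan_ubound[of "c * 2"] c by (intro divide_right_mono) auto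
    then show ?thesis by (intro mult_left_mono) auto
  qed
  finally show ?thesis by (simp add: power2_eq_square)
qed

text \<open>If w >= 2 |q| then q' <= - w / 2, which costs a factor 4; otherwise w^2 <= 4 q^2 and a
  constant depending on q is enough. The factor 4 + 4 q^2 covers both cases.\<close>

lemma inverse_quadratic_shift:
  fixes q q' w :: real
  assumes "q' \<le> q - w" "0 \<le> w"
  shows "1 / (1 + q'\<^sup>2) \<le> (4 + 4 * q\<^sup>2) * (1 / (1 + w\<^sup>2))"
proof -
  have pos: "1 + x\<^sup>2 > 0" for x :: real by (simp add: add_pos_nonneg)
  have "1 + w\<^sup>2 \<le> (4 + 4 * q\<^sup>2) * (1 + q'\<^sup>2)"
  proof (cases "w \<ge> 2 * \<bar>q\<bar>")
    case True
    then have "w / 2 \<le> - q'" using assms by linarith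
    then have "(w / 2)\<^sup>2 \<le> (- q')\<^sup>2" using assms(2) by (intro power_mono) auto
    then have "1 + w\<^sup>2 \<le> 4 * (1 + q'\<^sup>2)" by (simp add: power_divide)
    also have "\<dots> \<le> (4 + 4 * q\<^sup>2) * (1 + q'\<^sup>2)" by (intro mult_right_mono) auto
    finally show ?thesis .
  next
    case False
    then have "w\<^sup>2 \<le> (2 * \<bar>q\<bar>)\<^sup>2" using assms(2) by (intro power_mono) auto
    then have "1 + w\<^sup>2 \<le> (4 + 4 * q\<^sup>2) * 1" by (simp add: power_mult_distrib)
    also have "\<dots> \<le> (4 + 4 * q\<^sup>2) * (1 + q'\<^sup>2)" by (intro mult_left_mono) auto
    finally show ?thesis .
  qed
  then show ?thesis using pos by (simp add: divide_le_eq le_divide_eq mult_ac)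
qed

text \<open>The light cone with vertex \<open>(r - q, r \<omega>)\<close> meets the support of a source concentrated near
  \<open>r = t\<close> only in directions \<open>\<sigma>\<close> close to \<open>\<omega>\<close>.\<close>

lemma cone_retarded_time:
  fixes \<omega> \<sigma> :: "'a::real_inner"
  assumes "norm \<omega> = 1" "norm \<sigma> = 1" "r > 0" "z > 0"
  shows "norm (r *\<^sub>R \<omega> + (1 / z) *\<^sub>R \<sigma>) - (r - q + 1 / z) \<le> q - r / (z * r + 1) * (1 - \<omega> \<bullet> \<sigma>)"
proof -
  define N where "N = norm (r *\<^sub>R \<omega> + (1 / z) *\<^sub>R \<sigma>)"
  \<comment> \<open>The length the vector would have for \<sigma> = \<omega>. Its excess S - N over
    the true length is found from S^2 - N^2, which is explicit, and S + N <= 2 S.\<close>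
  define S where "S = r + 1 / z"
  have S: "S > 0" using assms by (simp add: S_def add_pos_pos)
  have N: "0 \<le> N" "N \<le> S"
    unfolding N_def S_def using norm_triangle_ineq[of "r *\<^sub>R \<omega>" "(1 / z) *\<^sub>R \<sigma>"] assms by auto
  have v: "0 \<le> 1 - \<omega> \<bullet> \<sigma>" using norm_cauchy_schwarz[of \<omega> \<sigma>] assms by simp
  have "N\<^sup>2 = r\<^sup>2 + (1 / z)\<^sup>2 + 2 * (r * (1 / z)) * (\<omega> \<bullet> \<sigma>)"
  proof -
    have "\<omega> \<bullet> \<omega> = 1" "\<sigma> \<bullet> \<sigma> = 1" using assms(1,2) by (simp_all add: dot_square_norm)
    then show ?thesis unfolding N_def power2_norm_eq_inner
      by (simp add: inner_add_left inner_add_right inner_commute[of \<sigma> \<omega>] power2_eq_square distrib_left add_divide_distrib)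
  qed
  then have "(S - N) * (S + N) = 2 * (r * (1 / z)) * (1 - \<omega> \<bullet> \<sigma>)"
    by (simp add: S_def power2_eq_square algebra_simps diff_divide_distrib)
  moreover have "(S - N) * (S + N) \<le> (S - N) * (2 * S)"
    using N by (intro mult_left_mono) auto
  ultimately have "(r * (1 / z)) * (1 - \<omega> \<bullet> \<sigma>) \<le> (S - N) * S" by linarith
  then have "(r * (1 / z)) * (1 - \<omega> \<bullet> \<sigma>) / S \<le> S - N" unfolding pos_divide_le_eq[OF S] .
  then have "(r * (1 / z)) / S * (1 - \<omega> \<bullet> \<sigma>) \<le> S - N" by (simp only: times_divide_eq_left)
  moreover have "(r * (1 / z)) / S = r / (z * r + 1)" using assms by (simp add: S_def field_simps)
  ultimately have "r / (z * r + 1) * (1 - \<omega> \<bullet> \<sigma>) \<le> S - N" by (simp only:)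
  then show ?thesis unfolding N_def S_def by linarith
qed

context wave_source
begin

text \<open>On the support of the cutoff |t - r| <= r / 2, hence r >= 2 t / 3, and decay in r
  becomes decay in t, which only grows along a forward cone. The constant 27/8 is (3/2)^3, and
  \<open>B\<close> bounds the cutoff, which is constant outside the compact interval
  {1/4..1/2}.\<close>

lemma source_bound:
  assumes g_bound: "\<And>q x. norm x = 1 \<Longrightarrow> \<bar>g (q, x)\<bar> \<le> C / (1 + q\<^sup>2)"
    and chi_1: "\<And>s. s < 1/4 \<Longrightarrow> chi s = 1"
  obtains D where "D \<ge> 0" "\<And>t x. t > 0 \<Longrightarrow> \<bar>source (t, x)\<bar> \<le> D / t ^ 3 * (1 / (1 + (norm x - t)\<^sup>2))"
proof -
  have "compact (chi ` {1/4..1/2})"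
    by (intro compact_continuous_image continuous_on_subset[OF C_inf_continuous[OF chi_smooth]]) auto
  then obtain B0 where "\<forall>y \<in> chi ` {1/4..1/2}. norm y \<le> B0"
    using compact_imp_bounded bounded_iff by blast
  then have B0: "\<bar>chi s\<bar> \<le> B0" if "s \<in> {1/4..1/2}" for s
    using that by auto
  define B where "B = max 1 B0"
  have "B \<ge> 0" by (simp add: B_def)
  moreover have "\<bar>chi s\<bar> \<le> B" for s
    using B0[of s] chi_0[of s] chi_1[of s] by (cases "s < 1/4"; cases "s > 1/2"; auto simp: B_def)
  ultimately have B: "\<bar>chi s\<bar> \<le> B" "B \<ge> 0" for s by auto
  have C: "C \<ge> 0"
    using g_bound[of "axis 1 1" 0] by simp
  have pos: "1 + y\<^sup>2 > 0" for y :: real by (simp add: add_pos_nonneg)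
  show ?thesis
  proof (rule that[of "27 / 8 * C * B"])
    show "27 / 8 * C * B \<ge> 0" using B C by simp
    fix t :: real and x :: "real^3" assume t: "t > 0"
    show "\<bar>source (t, x)\<bar> \<le> 27 / 8 * C * B / t ^ 3 * (1 / (1 + (norm x - t)\<^sup>2))"
    proof (cases "x = 0 \<or> jb (t - norm x) / norm x > 1/2")
      case True
      then have "source (t, x) = 0" by (auto simp: source_def chi_0)
      then show ?thesis using B C t pos[of "norm x - t"] by simp
    next
      case False
      define r where "r = norm x"
      have r: "r > 0" using False by (simp add: r_def)
      have "jb (t - r) \<le> r / 2" using False r by (simp add: r_def[symmetric] divide_le_eq not_less)
      then have tr: "2 / 3 * t \<le> r" using jb_ge_abs[of "t - r"] by linarith
      have "x = r *\<^sub>R (x /\<^sub>R r)" using r by simp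
      then have "g (r - t, x) = g (r - t, x /\<^sub>R r)" using g_homogeneous[OF r] by metis
      then have gb: "\<bar>g (r - t, x)\<bar> \<le> C / (1 + (r - t)\<^sup>2)"
        using g_bound[of "x /\<^sub>R r" "r - t"] r by (simp add: r_def)
      have "1 / r ^ 3 \<le> 1 / (2 / 3 * t) ^ 3"
        using tr t by (intro divide_left_mono power_mono) auto
      then have rb: "1 / r ^ 3 \<le> 27 / 8 / t ^ 3" by (simp add: power_mult_distrib power3_eq_cube)
      have "\<bar>source (t, x)\<bar> = \<bar>g (r - t, x)\<bar> * (1 / r ^ 3) * \<bar>chi (jb (t - r) / r)\<bar>"
        using r by (simp add: source_def r_def[symmetric] abs_mult)
      also have "\<dots> \<le> C / (1 + (r - t)\<^sup>2) * (27 / 8 / t ^ 3) * B"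
        using r C t pos[of "r - t"] by (intro mult_mono gb rb B) auto
      finally show ?thesis by (simp add: r_def mult_ac)
    qed
  qed
qed

text \<open>Every point of the forward cone has time at least t = r - q, so \<open>near\<close> is
  O(t^-3). For \<open>far\<close>, the cube of t + 1 / z absorbs the factor z^-3, and the
  concentration of directions near \<omega> contributes 1 / c = z + 1 / r; what remains is O(1 / r)
  times (1 + z t)^-2, with z-integral 1 / (1 + t). The potential is thus O(r^-2).\<close>

lemma potential_radiation:
  assumes g_bound: "\<And>q x. norm x = 1 \<Longrightarrow> \<bar>g (q, x)\<bar> \<le> C / (1 + q\<^sup>2)"
    and chi_1: "\<And>s. s < 1/4 \<Longrightarrow> chi s = 1"
    and \<omega>: "norm \<omega> = 1"
  shows "((\<lambda>r. r * potential (r - q, r *\<^sub>R \<omega>)) \<longlongrightarrow> 0) at_top"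
proof -
  obtain D where D: "D \<ge> 0" and src: "\<And>t x. t > 0 \<Longrightarrow> \<bar>source (t, x)\<bar> \<le> D / t ^ 3 * (1 / (1 + (norm x - t)\<^sup>2))"
    using source_bound[OF g_bound chi_1] by blast
  \<comment> \<open>Product of D, the factor 4 + 4 q^2 of \<open>inverse_quadratic_shift\<close>,
    pi^2 of the Cauchy kernel, and the 2 in \<open>1 / c \<le> 2 * (1 + z * t) / r\<close>.\<close>
  define E where "E = 8 * D * (1 + q\<^sup>2) * pi\<^sup>2"
  have E: "E \<ge> 0" using D by (simp add: E_def)
  have pos: "1 + y\<^sup>2 > 0" for y :: real by (simp add: add_pos_nonneg)
  have csrc: "continuous_on S (\<lambda>\<sigma>. source (a, y + b *\<^sub>R \<sigma>))" for S a b y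
    by (rule continuous_on_sphere_ray[OF C_inf_source])
  have bound: "\<bar>r * potential (r - q, r *\<^sub>R \<omega>)\<bar> \<le> (32 * pi * D + 2 * E) / r" if r: "r > max 1 (2 * \<bar>q\<bar>)" for r
  proof -
    define t where "t = r - q"
    define p where "p = (t, r *\<^sub>R \<omega>)"
    \<comment> \<open>The assumption r > 2 |q| makes powers of 1 / t and of 1 / r interchangeable up
      to constants.\<close>
    have r1: "r > 1" and t2: "2 * t \<ge> r" using r by (auto simp: t_def)
    then have t: "t > 0" by simp
    have near_b: "\<bar>near (p, \<rho>)\<bar> \<le> 4 * pi * (D / t ^ 3)" if \<rho>: "\<rho> \<ge> 0" for \<rho>
    proof -
      have "\<bar>near (p, \<rho>)\<bar> \<le> sphere_integral (\<lambda>_. D / t ^ 3)"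
        unfolding near_def p_def fst_conv snd_conv
      proof (rule sphere_integral_bound[OF csrc])
        fix \<sigma> :: "real^3"
        let ?y = "r *\<^sub>R \<omega> + \<rho> *\<^sub>R \<sigma>"
        have "\<bar>source (t + \<rho>, ?y)\<bar> \<le> D / (t + \<rho>) ^ 3 * (1 / (1 + (norm ?y - (t + \<rho>))\<^sup>2))"
          using t \<rho> by (intro src) simp
        also have "\<dots> \<le> D / t ^ 3 * 1"
          using t \<rho> D by (intro mult_mono divide_left_mono power_mono mult_pos_pos) (auto simp: pos divide_le_eq_1)
        finally show "\<bar>source (t + \<rho>, ?y)\<bar> \<le> D / t ^ 3" by simp
      qed auto
      then show ?thesis by (simp add: sphere_integral_const)
    qed
    have cnear: "continuous_on {0..1} (\<lambda>\<rho>. near (p, \<rho>))"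
      by (rule continuous_on_compose2[OF C_inf_continuous[OF C_inf_near]]) (auto intro!: continuous_intros)
    have 1: "\<bar>integral {0..1} (\<lambda>\<rho>. \<rho> * near (p, \<rho>))\<bar> \<le> 4 * pi * (D / t ^ 3)"
    proof -
      have "norm (integral {0..1} (\<lambda>\<rho>. \<rho> * near (p, \<rho>))) \<le> integral {0..1} (\<lambda>\<rho>::real. 4 * pi * (D / t ^ 3))"
      proof (rule integral_norm_bound_integral)
        fix \<rho> :: real assume \<rho>: "\<rho> \<in> {0..1}"
        have "\<bar>\<rho>\<bar> * \<bar>near (p, \<rho>)\<bar> \<le> 1 * (4 * pi * (D / t ^ 3))"
          using \<rho> by (intro mult_mono near_b) auto
        then show "norm (\<rho> * near (p, \<rho>)) \<le> 4 * pi * (D / t ^ 3)" by (simp add: abs_mult)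
      qed (auto intro!: integrable_continuous_interval continuous_intros cnear)
      then show ?thesis by simp
    qed
    have far_b: "\<bar>far (p, z)\<bar> \<le> E / r * (1 / (1 + z * t)\<^sup>2)" if z: "z > 0" for z
    proof -
      define c where "c = r / (z * r + 1)"
      have c: "c > 0" unfolding c_def using r1 z by (auto intro!: divide_pos_pos add_pos_pos)
      have zt: "1 + z * t > 0" using z t by (simp add: add_pos_pos)
      have "\<bar>near (p, 1 / z)\<bar> \<le> sphere_integral (\<lambda>\<sigma>. (D / (t + 1 / z) ^ 3 * (4 + 4 * q\<^sup>2)) * (1 / (1 + (c * (1 - \<omega> \<bullet> \<sigma>))\<^sup>2)))"
        unfolding near_def p_def fst_conv snd_conv
      proof (rule sphere_integral_bound[OF csrc])
        show "continuous_on (sphere 0 1) (\<lambda>\<sigma>. (D / (t + 1 / z) ^ 3 * (4 + 4 * q\<^sup>2)) * (1 / (1 + (c * (1 - \<omega> \<bullet> \<sigma>))\<^sup>2)))"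
          using pos by (intro continuous_intros) (metis less_irrefl)
        fix \<sigma> :: "real^3" assume \<sigma>: "norm \<sigma> = 1"
        let ?y = "r *\<^sub>R \<omega> + (1 / z) *\<^sub>R \<sigma>"
        have tz: "t + 1 / z > 0" using t z by (simp add: add_pos_pos)
        have v: "0 \<le> 1 - \<omega> \<bullet> \<sigma>" using norm_cauchy_schwarz[of \<omega> \<sigma>] \<omega> \<sigma> by simp
        have "\<bar>source (t + 1 / z, ?y)\<bar> \<le> D / (t + 1 / z) ^ 3 * (1 / (1 + (norm ?y - (t + 1 / z))\<^sup>2))"
          using tz by (rule src)
        also have "\<dots> \<le> D / (t + 1 / z) ^ 3 * ((4 + 4 * q\<^sup>2) * (1 / (1 + (c * (1 - \<omega> \<bullet> \<sigma>))\<^sup>2)))"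
        proof (intro mult_left_mono inverse_quadratic_shift)
          show "norm ?y - (t + 1 / z) \<le> q - c * (1 - \<omega> \<bullet> \<sigma>)"
            using cone_retarded_time[OF \<omega> \<sigma>, of r z q] r1 z by (simp add: c_def t_def)
        qed (use c v D tz in auto)
        finally show "\<bar>source (t + 1 / z, ?y)\<bar> \<le> (D / (t + 1 / z) ^ 3 * (4 + 4 * q\<^sup>2)) * (1 / (1 + (c * (1 - \<omega> \<bullet> \<sigma>))\<^sup>2))"
          by (simp only: mult.assoc)
      qed
      also have "\<dots> \<le> (D / (t + 1 / z) ^ 3 * (4 + 4 * q\<^sup>2)) * (pi\<^sup>2 / c)"
        unfolding sphere_integral_cmult using D t z
        by (intro mult_left_mono sphere_integral_cauchy_kernel \<omega> c) auto
      finally have nb: "\<bar>near (p, 1 / z)\<bar> \<le> (D / (t + 1 / z) ^ 3 * (4 + 4 * q\<^sup>2)) * (pi\<^sup>2 / c)" .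
      have tz: "t + 1 / z = (1 + z * t) / z" using z by (simp add: field_simps)
      have "\<bar>far (p, z)\<bar> = (1 / z ^ 3) * \<bar>near (p, 1 / z)\<bar>"
        using z by (simp add: far_eq_near abs_mult)
      also have "\<dots> \<le> (1 / z ^ 3) * ((D / (t + 1 / z) ^ 3 * (4 + 4 * q\<^sup>2)) * (pi\<^sup>2 / c))"
        using z nb by (intro mult_left_mono) auto
      also have "\<dots> = D * (4 + 4 * q\<^sup>2) * pi\<^sup>2 / (1 + z * t) ^ 3 * (1 / c)"
        using z by (simp add: tz power_divide)
      also have "1 / c \<le> 2 * (1 + z * t) / r"
      proof -
        have "z * r \<le> z * (2 * t)" using z t2 by (intro mult_left_mono) auto
        then show ?thesis unfolding c_def using r1 by (simp add: divide_right_mono algebra_simps)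
      qed
      then have "D * (4 + 4 * q\<^sup>2) * pi\<^sup>2 / (1 + z * t) ^ 3 * (1 / c) \<le>
          D * (4 + 4 * q\<^sup>2) * pi\<^sup>2 / (1 + z * t) ^ 3 * (2 * (1 + z * t) / r)"
        using D zt by (intro mult_left_mono) auto
      also have "\<dots> = E / r * (1 / (1 + z * t)\<^sup>2)"
      proof -
        have "D * (4 + 4 * q\<^sup>2) * pi\<^sup>2 / w ^ 3 * (2 * w / r) = E / r * (1 / w\<^sup>2)" if "w > 0" for w
          using that r1 by (simp add: E_def power2_eq_square power3_eq_cube field_simps)
        then show ?thesis using zt by blast
      qed
      finally show ?thesis .
    qed
    have cfar: "continuous_on {0..1} (\<lambda>z. far (p, z))"
      by (rule continuous_on_compose2[OF C_inf_continuous[OF C_inf_far]])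
         (auto intro!: continuous_intros simp: far_dom_unit[unfolded cbox_interval])
    have hi: "((\<lambda>z. E / r * (1 / (1 + z * t)\<^sup>2)) has_integral E / r * (1 / (1 + t))) {0..1}"
      by (rule has_integral_mult_right[OF integral_inverse_square[OF t]])
    have 2: "\<bar>integral {0..1} (\<lambda>z. far (p, z))\<bar> \<le> E / r * (1 / (1 + t))"
    proof -
      \<comment> \<open>The bound for \<open>far\<close> is available only for z > 0; changing the
        single value at 0 does not affect the integral.\<close>
      define f0 where "f0 = (\<lambda>z. if z = 0 then 0 else far (p, z))"
      have "integral {0..1} (\<lambda>z. far (p, z)) = integral {0..1} f0"
        by (rule integral_spike[of "{0}"]) (auto simp: f0_def)
      moreover have "f0 integrable_on {0..1}"
        by (rule integrable_spike[OF integrable_continuous_interval[OF cfar], of "{0}"]) (auto simp: f0_def)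
      then have "norm (integral {0..1} f0) \<le> integral {0..1} (\<lambda>z. E / r * (1 / (1 + z * t)\<^sup>2))"
      proof (rule integral_norm_bound_integral)
        show "(\<lambda>z. E / r * (1 / (1 + z * t)\<^sup>2)) integrable_on {0..1}" using hi by blast
        show "norm (f0 z) \<le> E / r * (1 / (1 + z * t)\<^sup>2)" if "z \<in> {0..1}" for z
          using far_b[of z] that E r1 by (auto simp: f0_def)
      qed
      ultimately show ?thesis using integral_unique[OF hi] by simp
    qed
    have "\<bar>r * potential p\<bar> \<le> r * (4 * pi * (D / t ^ 3) + E / r * (1 / (1 + t)))"
      using 1 2 r1 by (simp add: potential_def abs_mult mult_left_mono)
    also have "\<dots> \<le> r * (4 * pi * (D * (8 / r ^ 3)) + E / r * (2 / r))"
    proof -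
      have "(r / 2) ^ 3 \<le> t ^ 3" using t2 r1 by (intro power_mono) auto
      then have "1 / t ^ 3 \<le> 8 / r ^ 3" using t r1 by (simp add: field_simps power3_eq_cube)
      then have a: "D / t ^ 3 \<le> D * (8 / r ^ 3)" using D mult_left_mono[of "1 / t ^ 3" "8 / r ^ 3" D] by simp
      have b: "1 / (1 + t) \<le> 2 / r" using t t2 r1 by (simp add: field_simps)
      show ?thesis using r1 E by (intro mult_left_mono add_mono a b) auto
    qed
    also have "\<dots> = 32 * pi * D / r\<^sup>2 + 2 * E / r" using r1 by (simp add: field_simps power2_eq_square power3_eq_cube)
    also have "\<dots> \<le> 32 * pi * D / r + 2 * E / r"
      using r1 D E by (intro add_mono divide_left_mono) (auto simp: power2_eq_square)
    finally show ?thesis by (simp add: p_def t_def add_divide_distrib)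
  qed
  show ?thesis
  proof (rule Lim_null_comparison)
    show "\<forall>\<^sub>F r in at_top. norm (r * potential (r - q, r *\<^sub>R \<omega>)) \<le> (32 * pi * D + 2 * E) / r"
      using eventually_gt_at_top[of "max 1 (2 * \<bar>q\<bar>)"] by eventually_elim (use bound in simp)
    show "((\<lambda>r. (32 * pi * D + 2 * E) / r) \<longlongrightarrow> 0) at_top"
      by (rule real_tendsto_divide_at_top[OF tendsto_const filterlim_ident])
  qed
qed

end

section \<open>Assembly of the solution\<close>

lemma symbol_boundE:
  assumes "symbol_bound a f" "vs \<in> lists ang_dirs"
  obtains C where "\<And>q \<omega>. norm \<omega> = 1 \<Longrightarrow> \<bar>(wq ^^ k) (iter_dd vs (ext0 f)) (q, \<omega>)\<bar> \<le> C * jb q powr - a"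
proof -
  obtain C where "\<forall>q. \<forall>\<omega>\<in>sphere 0 1. \<bar>(wq ^^ k) (iter_dd vs (ext0 f)) (q, \<omega>)\<bar> \<le> C * jb q powr - a"
    using assms unfolding symbol_bound_def by blast
  then show ?thesis by (intro that[of C]) auto
qed

theorem theorem1p2:
  fixes \<gamma> :: real
    and chi chineg :: "real \<Rightarrow> real"
    and m Gt :: "real \<Rightarrow> real^3 \<Rightarrow> real"
    and M Q :: "real^3 \<Rightarrow> real"
    and Mbar :: real
  assumes \<gamma>: "1/2 \<le> \<gamma>" "\<gamma> < 1"
    and chi_smooth: "C_inf_on UNIV chi"
    and chi_1: "\<And>s. s < 1/4 \<Longrightarrow> chi s = 1"
    and chi_0: "\<And>s. s > 1/2 \<Longrightarrow> chi s = 0"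
    and chineg_smooth: "C_inf_on UNIV chineg"
    and chineg_1: "\<And>s. s < -1 \<Longrightarrow> chineg s = 1"
    and chineg_0: "\<And>s. s > 0 \<Longrightarrow> chineg s = 0"
    and m_smooth: "smooth_RS2 m"
    and m_bound: "symbol_bound (1 + 2 * \<gamma>) m"
    and M_def: "\<And>\<omega>. M \<omega> = integral UNIV (\<lambda>q. m q \<omega>)"
    and Mbar_def: "Mbar = 1 / (4 * pi) * sphere_integral M"
    and Q_smooth: "smooth_S2 Q"
    and Q_eq: "\<And>\<omega>. \<omega> \<in> sphere 0 1 \<Longrightarrow> lap_S2 Q \<omega> = - M \<omega> + Mbar"
    and Gt_smooth: "smooth_RS2 Gt"
    and Gt_bound: "symbol_bound 2 Gt"
    and Gt_int: "\<And>\<omega>. \<omega> \<in> sphere 0 1 \<Longrightarrow> ((\<lambda>q. Gt q \<omega>) has_integral Q \<omega>) UNIV"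
  shows "\<exists>\<phi> :: real \<times> (real^3) \<Rightarrow> real.
           C_inf_on UNIV \<phi>
         \<and> (\<forall>t x. box \<phi> (t, x)
               + m (norm x - t) (x /\<^sub>R norm x) / (norm x)^3 * chi (jb (t - norm x) / norm x) = 0)
         \<and> (\<forall>q. \<forall>\<omega>\<in>sphere 0 1.
               ((\<lambda>r. r * \<phi> (r - q, r *\<^sub>R \<omega>))
                 \<longlongrightarrow> Mbar * (1 / jb q) * chineg q + Gt q \<omega>) at_top)"
proof -
  have jb2: "jb q powr - 2 = 1 / (jb q)\<^sup>2" for q
    by (simp add: powr_minus divide_inverse powr_numeral)
  interpret wave_source "ext0 m" chi
  proof
    show "C_inf_on (UNIV \<times> (UNIV - {0})) (ext0 m)" using m_smooth by (simp add: smooth_RS2_def)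
    fix c q :: real and x :: "real^3" assume c: "c > 0"
    have "inverse (c * norm x) * c = inverse (norm x)"
      by (cases "norm x = 0") (use c in \<open>simp_all add: field_simps\<close>)
    then show "ext0 m (q, c *\<^sub>R x) = ext0 m (q, x)"
      using c by (simp add: ext0_def del: inverse_mult_distrib)
  qed (use chi_smooth chi_0 in auto)
  obtain Cm where Cm: "\<And>q \<omega>. norm \<omega> = 1 \<Longrightarrow> \<bar>ext0 m (q, \<omega>)\<bar> \<le> Cm * jb q powr - (1 + 2 * \<gamma>)"
    using symbol_boundE[OF m_bound, of "[]" 0] by (auto simp del: minus_add_distrib)
  have m_bd: "\<bar>ext0 m (q, \<omega>)\<bar> \<le> \<bar>Cm\<bar> / (1 + q\<^sup>2)" if "norm \<omega> = 1" for q \<omega>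
  proof -
    have "\<bar>ext0 m (q, \<omega>)\<bar> \<le> Cm * jb q powr - (1 + 2 * \<gamma>)" by (rule Cm[OF that])
    also have "\<dots> \<le> \<bar>Cm\<bar> * jb q powr - 2"
      \<comment> \<open>Here 1 + 2 \<gamma> >= 2 enters: the source decays at least like 1 / (1 +
        q^2).\<close>
      using \<gamma>(1) jb_ge_1[of q] by (intro mult_mono powr_mono) auto
    finally show ?thesis by (simp add: jb2 jb_sq)
  qed
  define G where "G = (\<lambda>p. Mbar * (1 / jb (fst p)) * chineg (fst p) + ext0 Gt p)"
  have Gt_s: "C_inf_on (UNIV \<times> (UNIV - {0})) (ext0 Gt)" using Gt_smooth by (simp add: smooth_RS2_def)
  have jnz: "jb q \<noteq> 0" for q using jb_pos(1)[of q] by linarith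
  let ?A = "\<lambda>p :: real \<times> (real^3). Mbar * (1 / jb (fst p)) * chineg (fst p)"
  have A_s: "C_inf_on UNIV ?A"
    by (intro C_inf_mult C_inf_divide C_inf_const C_inf_jb C_inf_linear_intros open_UNIV
        C_inf_compose_real[OF open_UNIV chineg_smooth] jnz UNIV_I)
  have G_s: "C_inf_on (UNIV \<times> (UNIV - {0})) G"
    unfolding G_def by (intro C_inf_add open_punctured Gt_s C_inf_subset[OF A_s]) simp
  obtain C0 where C0: "\<And>q \<omega>. norm \<omega> = 1 \<Longrightarrow> \<bar>ext0 Gt (q, \<omega>)\<bar> \<le> C0 * jb q powr - 2"
    using symbol_boundE[OF Gt_bound, of "[]" 0] by (auto simp del: minus_add_distrib)
  \<comment> \<open>One weighted derivative: dividing by the weight \<open>jb q\<close> inside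
    \<open>wq\<close> turns the exponent 2 into the exponent 3 required for the oscillation.\<close>
  obtain C1 where C1: "\<And>q \<omega>. norm \<omega> = 1 \<Longrightarrow> \<bar>wq (ext0 Gt) (q, \<omega>)\<bar> \<le> C1 * jb q powr - 2"
    using symbol_boundE[OF Gt_bound, of "[]" 1] by (auto simp del: minus_add_distrib)
  have dGt: "\<bar>dd (1, 0) (ext0 Gt) (q, \<omega>)\<bar> \<le> C1 / jb q ^ 3" if "norm \<omega> = 1" for q \<omega>
    using C1[OF that, of q] jb_pos(1)[of q]
    by (simp add: wq_def jb2 abs_mult field_simps power2_eq_square power3_eq_cube)
  have osc: "\<bar>dd (1, 0) G (q, \<sigma>) - dd (1, 0) G (q, \<omega>)\<bar> \<le> (2 * C1) / jb q ^ 3"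
    if "norm \<sigma> = 1" "norm \<omega> = 1" for q \<sigma> \<omega>
  proof -
    have "dd (1, 0) G (q, \<tau>) = dd (1, 0) ?A (q, \<tau>) + dd (1, 0) (ext0 Gt) (q, \<tau>)" if "norm \<tau> = 1" for \<tau>
      unfolding G_def
      by (rule dd_add; rule C_inf_differentiable[OF A_s] C_inf_differentiable[OF Gt_s]) (use that in auto)
    \<comment> \<open>The tail with \<open>Mbar\<close>, whose derivative decays only like <q>^-2,
      is the same in all directions and cancels in the difference.\<close>
    moreover have "dd (1, 0) ?A (q, \<sigma>) = dd (1, 0) ?A (q, \<omega>)" unfolding dd_def by simp
    ultimately show ?thesis using dGt[OF that(1), of q] dGt[OF that(2), of q] that
      by (simp add: abs_le_iff)
  qed
  have lim: "((\<lambda>q. G (q, \<omega>)) \<longlongrightarrow> 0) at_bot" if \<omega>: "norm \<omega> = 1" for \<omega>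
  proof (rule Lim_null_comparison)
    show "\<forall>\<^sub>F q in at_bot. norm (G (q, \<omega>)) \<le> (\<bar>Mbar\<bar> + \<bar>C0\<bar>) / - q"
    proof (rule eventually_mono)
      show "\<forall>\<^sub>F q in at_bot. q < (- 1 :: real)"
        unfolding eventually_at_bot_dense by (intro exI[of _ "-1"]) simp
      fix q :: real assume q: "q < - 1"
      have jq: "- q \<le> jb q" using jb_ge_abs[of q] by simp
      have "\<bar>ext0 Gt (q, \<omega>)\<bar> \<le> C0 * (1 / (jb q)\<^sup>2)" using C0[OF \<omega>, of q] by (simp add: jb2)
      also have "\<dots> \<le> \<bar>C0\<bar> * (1 / jb q)"
        using jb_ge_1[of q] by (intro mult_mono divide_left_mono) (auto simp: power2_eq_square)
      finally have "\<bar>G (q, \<omega>)\<bar> \<le> \<bar>Mbar\<bar> * (1 / jb q) + \<bar>C0\<bar> * (1 / jb q)"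
        using q by (simp add: G_def chineg_1 abs_mult abs_triangle_ineq[THEN order_trans])
      also have "\<dots> = (\<bar>Mbar\<bar> + \<bar>C0\<bar>) / jb q" by (simp add: add_divide_distrib)
      also have "\<dots> \<le> (\<bar>Mbar\<bar> + \<bar>C0\<bar>) / - q"
        using jq q by (intro divide_left_mono mult_pos_pos) auto
      finally show "norm (G (q, \<omega>)) \<le> (\<bar>Mbar\<bar> + \<bar>C0\<bar>) / - q" by simp
    qed
    show "((\<lambda>q. (\<bar>Mbar\<bar> + \<bar>C0\<bar>) / - q) \<longlongrightarrow> 0) at_bot"
      by (rule real_tendsto_divide_at_top[OF tendsto_const filterlim_uminus_at_top_at_bot])
  qed
  \<comment> \<open>The coefficients normalise the radiation field \<open>2 * pi * G\<close> of the
    free wave and the source term \<open>- 4 * pi * source\<close> of the potential.\<close>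
  define \<phi> where "\<phi> = (\<lambda>p. 1 / (2 * pi) * free_wave G p + 1 / (4 * pi) * potential p)"
  have "C_inf_on UNIV \<phi>"
    unfolding \<phi>_def by (intro C_inf_add C_inf_mult C_inf_const open_UNIV C_inf_free_wave G_s C_inf_potential)
  moreover have "box \<phi> (t, x) + m (norm x - t) (x /\<^sub>R norm x) / (norm x)^3 * chi (jb (t - norm x) / norm x) = 0" for t x
  proof -
    have "box \<phi> (t, x) = - source (t, x)"
      unfolding \<phi>_def by (subst box_linear[OF C_inf_free_wave[OF G_s] C_inf_potential])
        (simp add: box_free_wave[OF G_s] box_potential)
    then show ?thesis by (simp add: source_def ext0_def)
  qed
  moreover have "((\<lambda>r. r * \<phi> (r - q, r *\<^sub>R \<omega>)) \<longlongrightarrow> Mbar * (1 / jb q) * chineg q + Gt q \<omega>) at_top"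
    if "\<omega> \<in> sphere 0 1" for q \<omega>
  proof -
    have \<omega>: "norm \<omega> = 1" using that by simp
    have "((\<lambda>r. 1 / (2 * pi) * (r * free_wave G (r - q, r *\<^sub>R \<omega>)) + 1 / (4 * pi) * (r * potential (r - q, r *\<^sub>R \<omega>)))
       \<longlongrightarrow> 1 / (2 * pi) * (2 * pi * G (q, \<omega>)) + 1 / (4 * pi) * 0) at_top"
      by (intro tendsto_intros free_wave_radiation[OF G_s \<omega> lim[OF \<omega>] osc[OF _ \<omega>]]
          potential_radiation[OF m_bd chi_1 \<omega>])
    then show ?thesis by (simp add: \<phi>_def G_def ext0_def \<omega> algebra_simps)
  qed
  ultimately show ?thesis by blast
qed

end
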